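(* If $u \in \mathcal{U}$, then $\tilde{u} - u$ has nontangential limit $0$ at almost every point of $\partial D$.
   Context: $D$ is the open unit disk in $\mathbb{C}$ and $dA$ is area measure on $D$ normalized so that $D$ has measure $1$. $H^\infty$ is the algebra of bounded analytic functions on $D$, and $\mathcal{U}$ is the $C^*$-subalgebra of $L^\infty(D,dA)$ generated by $H^\infty$ (its elements are represented by bounded continuous functions on $D$, namely the uniform limits of finite sums of functions $f\bar g$ with $f,g\in H^\infty$). For $z\in D$, $k_z(w)=(1-|z|^2)/(1-\bar z w)^2$ is the normalized Bergman reproducing kernel. The Berezin transform of $u\in L^\infty(D,dA)$ is the function $\tilde u$ on $D$ given by $\tilde u(z)=\int_D u(w)|k_z(w)|^2\,dA(w)$. "Almost every point of $\partial D$" is with respect to arc length measure on $\partial D$. *)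

theory Defs
  imports "HOL-Complex_Analysis.Complex_Analysis" "HOL-Probability.Essential_Supremum"
begin

abbreviation disc :: "complex set" where
  "disc \<equiv> ball 0 1"

definition disc_area :: "complex measure" where
  "disc_area = uniform_measure (lebesgue_on disc) disc"

definition H_infinity :: "(complex \<Rightarrow> complex) set" where
  "H_infinity = {f. f holomorphic_on disc \<and> bounded (f ` disc)}"

definition Linf_norm :: "(complex \<Rightarrow> complex) \<Rightarrow> ereal" where
  "Linf_norm f = esssup disc_area (\<lambda>w. ereal (cmod (f w)))"

text \<open>Elements of \<open>L\<^sup>\<infinity>\<close> are rendered by functions, not by classes modulo equality almost
  everywhere; values outside the disc are irrelevant.\<close>

definition L_infinity :: "(complex \<Rightarrow> complex) set" where
  "L_infinity = {f \<in> borel_measurable disc_area. Linf_norm f < \<infinity>}"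

text \<open>The last conjunct says that the subalgebra is norm closed. It also forces the set to be
  saturated under equality almost everywhere (take a constant sequence), so such sets are exactly
  the preimages of the C*-subalgebras of the quotient.\<close>

definition cstar_subalgebra :: "(complex \<Rightarrow> complex) set \<Rightarrow> bool" where
  "cstar_subalgebra A \<longleftrightarrow>
     A \<subseteq> L_infinity \<and> A \<noteq> {} \<and>
     (\<forall>f\<in>A. \<forall>g\<in>A. (\<lambda>w. f w + g w) \<in> A) \<and>
     (\<forall>f\<in>A. \<forall>g\<in>A. (\<lambda>w. f w * g w) \<in> A) \<and>
     (\<forall>c. \<forall>f\<in>A. (\<lambda>w. c * f w) \<in> A) \<and>
     (\<forall>f\<in>A. (\<lambda>w. cnj (f w)) \<in> A) \<and>
     (\<forall>F. \<forall>f\<in>L_infinity. (\<forall>n::nat. F n \<in> A) \<and>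
        (\<lambda>n. Linf_norm (\<lambda>w. F n w - f w)) \<longlonglongrightarrow> 0 \<longrightarrow> f \<in> A)"

definition cstar_generated :: "(complex \<Rightarrow> complex) set \<Rightarrow> (complex \<Rightarrow> complex) set" where
  "cstar_generated S = \<Inter>{A. cstar_subalgebra A \<and> S \<subseteq> A}"

text \<open>Every element of the C*-algebra generated by \<open>H\<^sup>\<infinity>\<close> is almost everywhere equal to a
  continuous function on the disc, which is unique there and bounded (see
  \<open>cstar_generated_continuous_rep\<close> and \<open>continuous_rep_unique\<close> below). Elements are represented by
  that function: pointwise boundary behaviour is meaningless for other representatives.\<close>

definition U_algebra :: "(complex \<Rightarrow> complex) set" where
  "U_algebra = {u \<in> cstar_generated H_infinity. continuous_on disc u}"

definition bergman_kernel :: "complex \<Rightarrow> complex \<Rightarrow> complex" where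
  "bergman_kernel z w = (1 - (cmod z)\<^sup>2) / (1 - cnj z * w)\<^sup>2"

definition berezin :: "(complex \<Rightarrow> complex) \<Rightarrow> complex \<Rightarrow> complex" where
  "berezin u z = (\<integral>w. u w * (cmod (bergman_kernel z w))\<^sup>2 \<partial>disc_area)"

definition stolz_region :: "real \<Rightarrow> complex \<Rightarrow> complex set" where
  "stolz_region \<alpha> \<zeta> = {z \<in> disc. cmod (z - \<zeta>) < \<alpha> * (1 - cmod z)}"

definition has_nontangential_limit ::
    "(complex \<Rightarrow> complex) \<Rightarrow> complex \<Rightarrow> complex \<Rightarrow> bool" where
  "has_nontangential_limit h L \<zeta> \<longleftrightarrow>
     (\<forall>\<alpha>>1. (h \<longlongrightarrow> L) (at \<zeta> within stolz_region \<alpha> \<zeta>))"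

definition circle_arc_length :: "complex measure" where
  "circle_arc_length =
     distr (restrict_space lborel {0..<2*pi}) (restrict_space borel (sphere 0 1)) cis"

lemma emeasure_disc: "emeasure (lebesgue_on disc) disc = pi"
proof -
  have "emeasure (lebesgue_on disc) disc = emeasure lebesgue disc"
    by (simp add: emeasure_restrict_space)
  also have "\<dots> = pi"
    by (simp add: emeasure_ball unit_ball_vol_2)
  finally show ?thesis .
qed

lemma space_disc_area [simp]: "space disc_area = disc"
  by (simp add: disc_area_def space_restrict_space)

lemma sets_disc_area: "sets disc_area = sets (lebesgue_on disc)"
  by (simp add: disc_area_def)

lemma emeasure_disc_area: "emeasure disc_area disc = 1"
  unfolding disc_area_def
  by (rule emeasure_uniform_measure_1) (simp_all add: emeasure_disc)

lemma AE_disc_area: "(AE w in disc_area. P w) \<longleftrightarrow> (AE w in lebesgue. w \<in> disc \<longrightarrow> P w)"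
proof -
  have d: "disc \<in> sets (lebesgue_on disc)"
    by (simp add: sets_restrict_space_iff)
  have "(AE w in disc_area. P w) \<longleftrightarrow> (AE w in lebesgue_on disc. w \<in> disc \<longrightarrow> P w)"
    unfolding disc_area_def using d
    by (subst AE_uniform_measure) (auto simp: emeasure_disc)
  also have "\<dots> \<longleftrightarrow> (AE w in lebesgue. w \<in> disc \<longrightarrow> P w)"
    by (subst AE_restrict_space_iff) auto
  finally show ?thesis .
qed

lemma AE_continuous_le:
  fixes g :: "complex \<Rightarrow> real"
  assumes g: "continuous_on disc g" and ae: "AE w in disc_area. g w \<le> c" and w: "w \<in> disc"
  shows "g w \<le> c"
proof (rule ccontr)
  assume n: "\<not> g w \<le> c"
  define S where "S = disc \<inter> g -` {c<..}"
  have o: "open S"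
    unfolding S_def by (rule continuous_open_preimage[OF g]) auto
  have "AE x in lebesgue. x \<in> S \<longrightarrow> x \<in> {}"
    using ae unfolding AE_disc_area by eventually_elim (auto simp: S_def)
  moreover have "w \<in> S" using n w by (auto simp: S_def)
  ultimately show False
    using mem_closed_if_AE_lebesgue_open[of S "{}" w] o by auto
qed

lemma continuous_rep_unique:
  fixes u v :: "complex \<Rightarrow> complex"
  assumes "continuous_on disc u" "continuous_on disc v" "AE w in disc_area. u w = v w"
    and "w \<in> disc"
  shows "u w = v w"
proof -
  have "cmod (u w - v w) \<le> 0"
    by (rule AE_continuous_le[OF _ _ \<open>w \<in> disc\<close>])
       (use assms in \<open>auto intro!: continuous_intros elim: eventually_mono\<close>)
  then show ?thesis by simp
qed

lemma continuous_imp_measurable: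
  "continuous_on disc f \<Longrightarrow> (f :: complex \<Rightarrow> complex) \<in> borel_measurable disc_area"
  using continuous_imp_measurable_on_sets_lebesgue[of disc f] sets_disc_area
  by (auto cong: measurable_cong_sets)

lemma measurable_cmod: "f \<in> borel_measurable disc_area \<Longrightarrow>
    (\<lambda>w. ereal (cmod (f w))) \<in> borel_measurable disc_area"
  by measurable

lemma Linf_normI:
  assumes "f \<in> borel_measurable disc_area" "AE w in disc_area. cmod (f w) \<le> c"
  shows "Linf_norm f \<le> ereal c"
  unfolding Linf_norm_def
  by (rule esssup_I) (use assms measurable_cmod in auto)

lemma Linf_normD:
  assumes "Linf_norm f \<le> ereal c"
  shows "AE w in disc_area. cmod (f w) \<le> c"
proof -
  have "AE w in disc_area. ereal (cmod (f w)) \<le> Linf_norm f"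
    unfolding Linf_norm_def by (rule esssup_AE)
  then show ?thesis
    by eventually_elim (use assms order_trans in fastforce)
qed

lemma L_infinity_iff:
  "f \<in> L_infinity \<longleftrightarrow>
     f \<in> borel_measurable disc_area \<and> (\<exists>c. AE w in disc_area. cmod (f w) \<le> c)"
proof
  assume f: "f \<in> L_infinity"
  then have "\<exists>c. Linf_norm f \<le> ereal c"
    by (cases "Linf_norm f") (auto simp: L_infinity_def)
  then obtain c where "Linf_norm f \<le> ereal c" ..
  with f show "f \<in> borel_measurable disc_area \<and> (\<exists>c. AE w in disc_area. cmod (f w) \<le> c)"
    using Linf_normD by (auto simp: L_infinity_def)
next
  assume "f \<in> borel_measurable disc_area \<and> (\<exists>c. AE w in disc_area. cmod (f w) \<le> c)"
  then obtain c where "f \<in> borel_measurable disc_area" "Linf_norm f \<le> ereal c"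
    using Linf_normI by blast
  then show "f \<in> L_infinity"
    by (auto simp: L_infinity_def intro: le_less_trans)
qed

lemma Linf_norm_eq_0:
  assumes "f \<in> borel_measurable disc_area" "AE w in disc_area. f w = 0"
  shows "Linf_norm f = 0"
proof -
  have "Linf_norm f = esssup disc_area (\<lambda>w. 0 :: ereal)"
    unfolding Linf_norm_def
    by (rule esssup_AE_cong) (use assms measurable_cmod in \<open>auto elim: eventually_mono\<close>)
  also have "\<dots> = 0"
    by (rule esssup_const) (simp add: emeasure_disc_area)
  finally show ?thesis .
qed

lemma cstar_subalgebra_continuous_rep:
  "cstar_subalgebra {f \<in> L_infinity. \<exists>g. continuous_on disc g \<and> (AE w in disc_area. f w = g w)}"
    (is "cstar_subalgebra ?B")
proof -
  have zero: "(\<lambda>_. 0) \<in> ?B"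
    by (auto simp: L_infinity_iff intro!: exI[of _ "\<lambda>_. 0"] exI[of _ "0::real"])
  have add: "(\<lambda>w. f w + g w) \<in> ?B" if fg: "f \<in> ?B" "g \<in> ?B" for f g
  proof -
    from fg obtain c d f' g' where *: "AE w in disc_area. cmod (f w) \<le> c" "AE w in disc_area. cmod (g w) \<le> d"
      "continuous_on disc f'" "AE w in disc_area. f w = f' w"
      "continuous_on disc g'" "AE w in disc_area. g w = g' w"
      "f \<in> borel_measurable disc_area" "g \<in> borel_measurable disc_area"
      by (auto simp: L_infinity_iff)
    have "AE w in disc_area. cmod (f w + g w) \<le> c + d"
      using *(1,2) by eventually_elim (metis norm_add_rule_thm)
    moreover have "AE w in disc_area. f w + g w = f' w + g' w"
      using *(4,6) by eventually_elim simp
    moreover have "continuous_on disc (\<lambda>w. f' w + g' w)"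
      using * by (intro continuous_intros)
    ultimately show ?thesis using * by (auto simp: L_infinity_iff)
  qed
  have mult: "(\<lambda>w. f w * g w) \<in> ?B" if fg: "f \<in> ?B" "g \<in> ?B" for f g
  proof -
    from fg obtain c d f' g' where *: "AE w in disc_area. cmod (f w) \<le> c" "AE w in disc_area. cmod (g w) \<le> d"
      "continuous_on disc f'" "AE w in disc_area. f w = f' w"
      "continuous_on disc g'" "AE w in disc_area. g w = g' w"
      "f \<in> borel_measurable disc_area" "g \<in> borel_measurable disc_area"
      by (auto simp: L_infinity_iff)
    have "AE w in disc_area. cmod (f w * g w) \<le> c * d"
      using *(1,2) by eventually_elim (simp add: norm_mult mult_mono')
    moreover have "AE w in disc_area. f w * g w = f' w * g' w"
      using *(4,6) by eventually_elim simp
    moreover have "continuous_on disc (\<lambda>w. f' w * g' w)"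
      using * by (intro continuous_intros)
    ultimately show ?thesis using * by (auto simp: L_infinity_iff)
  qed
  have scale: "(\<lambda>w. c * f w) \<in> ?B" if f: "f \<in> ?B" for f c
    by (rule mult[OF _ f])
       (auto simp: L_infinity_iff intro!: exI[of _ "\<lambda>_. c"] exI[of _ "cmod c"])
  have conj: "(\<lambda>w. cnj (f w)) \<in> ?B" if f: "f \<in> ?B" for f
  proof -
    from f obtain c f' where *: "AE w in disc_area. cmod (f w) \<le> c"
      "continuous_on disc f'" "AE w in disc_area. f w = f' w" "f \<in> borel_measurable disc_area"
      by (auto simp: L_infinity_iff)
    have "AE w in disc_area. cnj (f w) = cnj (f' w)"
      using *(3) by eventually_elim simp
    moreover have "continuous_on disc (\<lambda>w. cnj (f' w))"
      using * by (intro continuous_intros)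
    moreover have "(\<lambda>w. cnj (f w)) \<in> borel_measurable disc_area"
      by (rule measurable_compose[OF *(4)])
         (intro borel_measurable_continuous_onI continuous_intros)
    moreover have "AE w in disc_area. cmod (cnj (f w)) \<le> c"
      using *(1) by simp
    ultimately show ?thesis unfolding L_infinity_iff by blast
  qed
  have closed: "f \<in> ?B"
    if f: "f \<in> L_infinity" and F: "\<And>n::nat. F n \<in> ?B"
      and lim: "(\<lambda>n. Linf_norm (\<lambda>w. F n w - f w)) \<longlonglongrightarrow> 0" for F f
  proof -
    from F have "\<exists>g. continuous_on disc g \<and> (AE w in disc_area. F n w = g w)" for n
      by blast
    then obtain G where G: "\<And>n. continuous_on disc (G n)" "\<And>n. AE w in disc_area. F n w = G n w"
      by metis
    have close: "\<exists>N. \<forall>n\<ge>N. AE w in disc_area. cmod (G n w - f w) \<le> e" if "e > 0" for e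
    proof -
      from lim have "\<forall>\<^sub>F n in sequentially. Linf_norm (\<lambda>w. F n w - f w) < ereal e"
        using that by (intro order_tendstoD) (auto simp: zero_ereal_def)
      then obtain N where N: "\<And>n. n \<ge> N \<Longrightarrow> Linf_norm (\<lambda>w. F n w - f w) \<le> ereal e"
        by (auto simp: eventually_sequentially intro: less_imp_le)
      have "AE w in disc_area. cmod (G n w - f w) \<le> e" if "n \<ge> N" for n
        using Linf_normD[OF N[OF that]] G(2)[of n] by eventually_elim simp
      then show ?thesis by blast
    qed
    have "uniformly_Cauchy_on disc G"
      unfolding uniformly_Cauchy_on_def
    proof (intro allI impI)
      fix e :: real assume e: "e > 0"
      obtain N where N: "\<forall>n\<ge>N. AE w in disc_area. cmod (G n w - f w) \<le> e / 3"
        using close[of "e / 3"] e by auto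
      have "dist (G m w) (G n w) < e" if "m \<ge> N" "n \<ge> N" "w \<in> disc" for m n w
      proof -
        have "AE w in disc_area. cmod (G m w - f w) \<le> e / 3" "AE w in disc_area. cmod (G n w - f w) \<le> e / 3"
          using N that by auto
        then have "AE w in disc_area. cmod (G m w - G n w) \<le> 2 * e / 3"
        proof eventually_elim
          case (elim w)
          show ?case
            using norm_triangle_ineq4[of "G m w - f w" "G n w - f w"] elim by simp
        qed
        then have "cmod (G m w - G n w) \<le> 2 * e / 3"
          by (rule AE_continuous_le[rotated]) (use that G in \<open>auto intro!: continuous_intros\<close>)
        with e show ?thesis by (simp add: dist_norm)
      qed
      then show "\<exists>M. \<forall>x\<in>disc. \<forall>m\<ge>M. \<forall>n\<ge>M. dist (G m x) (G n x) < e" by blast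
    qed
    then obtain g where g: "uniform_limit disc G g sequentially"
      by (auto simp: uniformly_convergent_eq_Cauchy[symmetric] uniformly_convergent_on_def
            dest: Cauchy_uniformly_convergent)
    have cg: "continuous_on disc g"
      by (rule uniform_limit_theorem[OF _ g]) (auto simp: G)
    have "AE w in disc_area. \<forall>k::nat. \<exists>N. \<forall>n\<ge>N. cmod (G n w - f w) \<le> 1 / Suc k"
    proof (subst AE_all_countable, intro allI)
      fix k :: nat
      obtain N where "\<forall>n\<ge>N. AE w in disc_area. cmod (G n w - f w) \<le> 1 / Suc k"
        using close[of "1 / Suc k"] by auto
      then have "AE w in disc_area. \<forall>n. n \<ge> N \<longrightarrow> cmod (G n w - f w) \<le> 1 / Suc k"
        by (subst AE_all_countable) auto
      then show "AE w in disc_area. \<exists>N. \<forall>n\<ge>N. cmod (G n w - f w) \<le> 1 / Suc k"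
        by eventually_elim blast
    qed
    moreover have "AE w in disc_area. w \<in> disc"
      using AE_space[of disc_area] by simp
    ultimately have "AE w in disc_area. f w = g w"
    proof eventually_elim
      case (elim w)
      have "(\<lambda>n. G n w) \<longlonglongrightarrow> f w"
      proof (rule LIMSEQ_I)
        fix r :: real assume "r > 0"
        then obtain k :: nat where k: "1 / Suc k < r"
          using nat_approx_posE by blast
        with elim(1) show "\<exists>no. \<forall>n\<ge>no. norm (G n w - f w) < r"
          by (meson le_less_trans)
      qed
      moreover have "(\<lambda>n. G n w) \<longlonglongrightarrow> g w"
        by (rule tendsto_uniform_limitI[OF g elim(2)])
      ultimately show ?case by (rule LIMSEQ_unique)
    qed
    with f cg show ?thesis by blast
  qed
  show ?thesis
    unfolding cstar_subalgebra_def
  proof (intro conjI allI ballI impI)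
    show "?B \<noteq> {}" using zero by blast
    show "?B \<subseteq> L_infinity" by blast
  next
    fix F f
    assume "f \<in> L_infinity"
      and "(\<forall>n. F n \<in> ?B) \<and> (\<lambda>n. Linf_norm (\<lambda>w. F n w - f w)) \<longlonglongrightarrow> 0"
    then show "f \<in> ?B"
      by (intro closed[of f F]) blast+
  qed (fact add mult scale conj)+
qed

lemma H_infinity_continuous_rep:
  "H_infinity \<subseteq> {f \<in> L_infinity. \<exists>g. continuous_on disc g \<and> (AE w in disc_area. f w = g w)}"
proof
  fix f assume f: "f \<in> H_infinity"
  then have c: "continuous_on disc f"
    by (auto simp: H_infinity_def holomorphic_on_imp_continuous_on)
  obtain b where "\<And>w. w \<in> disc \<Longrightarrow> cmod (f w) \<le> b"
    using f unfolding H_infinity_def bounded_iff by blast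
  then have "AE w in disc_area. cmod (f w) \<le> b"
    by (intro AE_I2) simp
  with c show "f \<in> {f \<in> L_infinity. \<exists>g. continuous_on disc g \<and> (AE w in disc_area. f w = g w)}"
    using continuous_imp_measurable[OF c] by (auto simp: L_infinity_iff)
qed

lemma cstar_generated_continuous_rep:
  assumes u: "u \<in> cstar_generated H_infinity"
  shows "\<exists>v\<in>U_algebra. bounded (v ` disc) \<and> (AE w in disc_area. u w = v w)"
proof -
  have "u \<in> {f \<in> L_infinity. \<exists>g. continuous_on disc g \<and> (AE w in disc_area. f w = g w)}"
    using u cstar_subalgebra_continuous_rep H_infinity_continuous_rep
    unfolding cstar_generated_def by blast
  then obtain v where uL: "u \<in> L_infinity" and v: "continuous_on disc v"
    and ae: "AE w in disc_area. u w = v w" by blast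
  from uL obtain c where um: "u \<in> borel_measurable disc_area"
    and c: "AE w in disc_area. cmod (u w) \<le> c" by (auto simp: L_infinity_iff)
  have vm: "v \<in> borel_measurable disc_area" by (rule continuous_imp_measurable[OF v])
  have vc: "AE w in disc_area. cmod (v w) \<le> c"
    using ae c by eventually_elim simp
  have "cmod (v w) \<le> c" if "w \<in> disc" for w
    by (rule AE_continuous_le[OF _ vc that]) (use v in \<open>auto intro!: continuous_intros\<close>)
  then have b: "bounded (v ` disc)" unfolding bounded_iff by blast
  have vL: "v \<in> L_infinity" using vm vc by (auto simp: L_infinity_iff)
  have n0: "Linf_norm (\<lambda>w. u w - v w) = 0"
    using um vm ae by (intro Linf_norm_eq_0) (auto elim: eventually_mono)
  have "v \<in> A" if A: "cstar_subalgebra A" "H_infinity \<subseteq> A" for A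
  proof -
    have uA: "u \<in> A" using u A by (auto simp: cstar_generated_def)
    have "\<forall>F. \<forall>f\<in>L_infinity. (\<forall>n::nat. F n \<in> A) \<and>
        (\<lambda>n. Linf_norm (\<lambda>w. F n w - f w)) \<longlonglongrightarrow> 0 \<longrightarrow> f \<in> A"
      using A(1) unfolding cstar_subalgebra_def by blast
    from this[rule_format, of v "\<lambda>_. u"] show ?thesis
      using vL uA n0 by simp
  qed
  then have "v \<in> U_algebra"
    using v by (auto simp: U_algebra_def cstar_generated_def)
  with b ae show ?thesis by blast
qed

end

theory Submission
  imports Defs "HOL-Probability.Distribution_Functions"
begin

text \<open>For \<open>f\<close> in \<open>H\<^sup>\<infinity>\<close> let \<open>H(z) = \<integral> |f(w) - f(z)|\<^sup>2 |k\<^sub>z(w)|\<^sup>2 dA(w)\<close>. The reproducing property turns this into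
  the variance \<open>B(|f|\<^sup>2)(z) - |f(z)|\<^sup>2\<close>, whose average over a circle is an explicit nonnegative series in
  the Taylor coefficients of \<open>f\<close> and in \<open>|z|\<^sup>2\<close>. Integrating it gives
  \<open>\<integral> H(z) / (1 - |z|\<^sup>2) dA(z) \<le> 2 \<Sum> |a\<^sub>n|\<^sup>2 < \<infinity>\<close>, so by Fubini \<open>\<integral> H(z) / (1 - |z|\<^sup>2)\<^sup>2 dA(z)\<close> over the
  Stolz regions at \<open>\<zeta>\<close> is finite for almost every \<open>\<zeta>\<close>. Since \<open>H(z) \<le> 81 H(z')\<close> for
  \<open>|z - z'| < (1 - |z|) / 2\<close>, the value \<open>H(z)\<close> is controlled by the part of that integral near \<open>\<zeta>\<close>,
  hence tends to 0 nontangentially. Neither Fatou's theorem nor a conformal change of variables is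
  needed. The functions whose \<open>L\<^sup>1\<close> mean oscillation \<open>\<integral> |u(w) - u(z)| |k\<^sub>z(w)|\<^sup>2 dA(w)\<close> vanishes
  nontangentially almost everywhere form a \<open>C\<^sup>*\<close>-algebra, which therefore contains the algebra generated by \<open>H\<^sup>\<infinity>\<close>; and this
  oscillation dominates the difference of \<open>u\<close> and its Berezin transform.\<close>

subsection \<open>Area measure on the disc\<close>

text \<open>The weights are dictated by geometry. A point z lies in a cone of fixed aperture at
  \<zeta> only for \<zeta> in an arc of length about 1 - |z|. Bounding a value by local averages
  calls for the Moebius invariant area (1 - |z|^2)^-2 dA, under which discs of radius (1 - |z|)/2
  are never small. Integrating over the boundary multiplies this area by the arc length, so the
  weight 1/(1 - |z|^2) remains for the coefficient series to absorb. Squares serve the analytic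
  functions: orthogonality diagonalizes circular averages, and since f(z) is the mean of f for the
  density |k_z|^2, H(z) is the least second moment about any centre. Hence H(z) and H(z') can be
  compared although both density and centre move. First powers serve the algebra: the triangle
  inequality then bounds sums, products and uniform limits linearly. Polar coordinates are replaced
  by two facts: |w|^2 is uniformly distributed under normalized area, and area is rotation
  invariant. Oscillation at a point is meaningful only for a continuous representative, so
  membership in the algebra carries one along.\<close>

text \<open>\<open>disc_area\<close> carries Lebesgue sets, whereas the rotation and Fubini
  arguments use Borel functions; the identity map links the two structures.\<close>

lemma measurable_disc_area_borel: "(\<lambda>w. w) \<in> disc_area \<rightarrow>\<^sub>M restrict_space borel disc"
proof -
  have "(\<lambda>w. w) \<in> lebesgue_on disc \<rightarrow>\<^sub>M restrict_space borel disc"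
    by (rule measurable_restrict_space3) (auto simp: measurable_completion)
  then show ?thesis
    by (simp add: sets_disc_area cong: measurable_cong_sets)
qed

lemma measurable_disc_areaI:
  "F \<in> restrict_space borel disc \<rightarrow>\<^sub>M N \<Longrightarrow> F \<in> disc_area \<rightarrow>\<^sub>M N"
  by (rule measurable_compose[OF measurable_disc_area_borel])

lemma prob_space_disc_area: "prob_space disc_area"
  by (rule prob_spaceI) (simp add: emeasure_disc_area)

lemma nn_integral_disc_area:
  fixes F :: "complex \<Rightarrow> ennreal"
  assumes F[measurable]: "F \<in> borel_measurable (restrict_space borel disc)"
  shows "(\<integral>\<^sup>+w. F w \<partial>disc_area) = (\<integral>\<^sup>+w. F w * indicator disc w \<partial>lborel) / pi"
proof -
  have F': "F \<in> borel_measurable (lebesgue_on disc)"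
    using measurable_disc_areaI[OF F] by (simp add: sets_disc_area cong: measurable_cong_sets)
  have d: "disc \<in> sets (lebesgue_on disc)"
    by (simp add: sets_restrict_space_iff)
  have "(\<integral>\<^sup>+w. F w \<partial>disc_area) = (\<integral>\<^sup>+w. F w * indicator disc w \<partial>lebesgue_on disc) / pi"
    unfolding disc_area_def by (subst nn_integral_uniform_measure[OF F' d]) (simp add: emeasure_disc)
  also have "(\<integral>\<^sup>+w. F w * indicator disc w \<partial>lebesgue_on disc) =
      (\<integral>\<^sup>+w. F w * indicator disc w * indicator disc w \<partial>lebesgue)"
    by (subst nn_integral_restrict_space) auto
  also have "\<dots> = (\<integral>\<^sup>+w. F w * indicator disc w \<partial>lebesgue)"
    by (intro nn_integral_cong) (simp split: split_indicator)
  also have "\<dots> = (\<integral>\<^sup>+w. F w * indicator disc w \<partial>lborel)"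
    by (rule nn_integral_completion)
  finally show ?thesis .
qed

text \<open>Uniqueness of Haar measure, specialized to a rotation: integrate
  \<open>indicator A (\<zeta> * x) * indicator B (y - x)\<close> in both orders, with \<open>B\<close> the unit ball.\<close>

lemma lborel_nn_integral_rotate:
  fixes F :: "complex \<Rightarrow> ennreal"
  assumes F[measurable]: "F \<in> borel_measurable borel" and z: "cmod \<zeta> = 1"
  shows "(\<integral>\<^sup>+w. F (\<zeta> * w) \<partial>lborel) = (\<integral>\<^sup>+w. F w \<partial>lborel)"
proof -
  define B :: "complex \<Rightarrow> ennreal" where "B = indicator disc"
  have B[measurable]: "B \<in> borel_measurable borel" unfolding B_def by (rule borel_measurable_indicator) simp
  \<comment> \<open>Rotation invariance of the ball removes \<zeta> from the second factor; its
    finite positive area is cancelled at the end.\<close>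
  have Brot: "B (\<zeta> * w) = B w" "B (- w) = B w" for w
    by (auto simp: B_def norm_mult z indicator_def)
  have shift: "(\<integral>\<^sup>+x. G (c + x) \<partial>lborel) = (\<integral>\<^sup>+x. G x \<partial>lborel)"
    if G[measurable]: "G \<in> borel_measurable borel" for G :: "complex \<Rightarrow> ennreal" and c
  proof -
    have "(\<integral>\<^sup>+x. G x \<partial>lborel) = (\<integral>\<^sup>+x. G x \<partial>distr lborel borel ((+) c))"
      by (simp add: lborel_distr_plus)
    also have "\<dots> = (\<integral>\<^sup>+x. G (c + x) \<partial>lborel)"
      by (subst nn_integral_distr) auto
    finally show ?thesis by simp
  qed
  have neg: "(\<integral>\<^sup>+x. G (- x) \<partial>lborel) = (\<integral>\<^sup>+x. G x \<partial>lborel)"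
    if G[measurable]: "G \<in> borel_measurable borel" for G :: "complex \<Rightarrow> ennreal"
  proof -
    have "lborel = distr lborel borel (uminus :: complex \<Rightarrow> complex)"
      using lborel_affine[of "-1" "0::complex"] by (simp add: density_1)
    then have "(\<integral>\<^sup>+x. G x \<partial>lborel) = (\<integral>\<^sup>+x. G x \<partial>distr lborel borel uminus)"
      by simp
    also have "\<dots> = (\<integral>\<^sup>+x. G (- x) \<partial>lborel)"
      by (subst nn_integral_distr) auto
    finally show ?thesis by simp
  qed
  have Bv: "(\<integral>\<^sup>+w. B w \<partial>lborel) = ennreal pi"
    by (simp add: B_def emeasure_ball unit_ball_vol_2)
  have "(\<integral>\<^sup>+w. F (\<zeta> * w) \<partial>lborel) * pi = (\<integral>\<^sup>+x. \<integral>\<^sup>+y. F (\<zeta> * x) * B (\<zeta> * x + y) \<partial>lborel \<partial>lborel)"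
    using shift[of B] by (simp add: nn_integral_cmult nn_integral_multc Bv)
  also have "\<dots> = (\<integral>\<^sup>+y. \<integral>\<^sup>+x. F (\<zeta> * x) * B (\<zeta> * x + y) \<partial>lborel \<partial>lborel)"
    by (rule lborel_pair.Fubini'[symmetric]) measurable
  also have "\<dots> = (\<integral>\<^sup>+y. \<integral>\<^sup>+x. F (\<zeta> * x + - y) * B x \<partial>lborel \<partial>lborel)"
  proof (rule nn_integral_cong)
    fix y :: complex
    have "\<zeta> \<noteq> 0" using z by auto
    then have "(\<integral>\<^sup>+x. F (\<zeta> * x) * B (\<zeta> * x + y) \<partial>lborel) = (\<integral>\<^sup>+x. F (\<zeta> * x + - y) * B (\<zeta> * x) \<partial>lborel)"
      using shift[of "\<lambda>x. F (\<zeta> * x) * B (\<zeta> * x + y)" "- y / \<zeta>"] by (simp add: ring_distribs)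
    then show "(\<integral>\<^sup>+x. F (\<zeta> * x) * B (\<zeta> * x + y) \<partial>lborel) = (\<integral>\<^sup>+x. F (\<zeta> * x + - y) * B x \<partial>lborel)"
      by (simp only: Brot)
  qed
  also have "\<dots> = (\<integral>\<^sup>+x. \<integral>\<^sup>+y. F (\<zeta> * x + - y) * B x \<partial>lborel \<partial>lborel)"
    by (rule lborel_pair.Fubini') measurable
  also have "\<dots> = (\<integral>\<^sup>+x. (\<integral>\<^sup>+y. F y \<partial>lborel) * B x \<partial>lborel)"
    using neg[of "\<lambda>y. F (\<zeta> * x + y)" for x] shift[of F] by (simp add: nn_integral_multc)
  also have "\<dots> = (\<integral>\<^sup>+w. F w \<partial>lborel) * pi"
    by (simp add: nn_integral_cmult Bv)
  finally show ?thesis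
    using pi_gt_zero by (simp add: mult_right_ennreal_cancel not_le)
qed

lemma measurable_disc_rotate:
  assumes "cmod \<zeta> = 1"
  shows "(\<lambda>w. \<zeta> * w) \<in> restrict_space borel disc \<rightarrow>\<^sub>M restrict_space borel disc"
  by (rule measurable_restrict_space3) (use assms in \<open>auto simp: norm_mult\<close>)

lemma nn_integral_disc_area_rotate:
  fixes F :: "complex \<Rightarrow> ennreal"
  assumes F: "F \<in> borel_measurable (restrict_space borel disc)" and z: "cmod \<zeta> = 1"
  shows "(\<integral>\<^sup>+w. F (\<zeta> * w) \<partial>disc_area) = (\<integral>\<^sup>+w. F w \<partial>disc_area)"
proof -
  have F': "(\<lambda>w. F w * indicator disc w) \<in> borel_measurable borel"
    using F borel_measurable_restrict_space_iff_ennreal[of disc borel F] by simp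
  have "(\<integral>\<^sup>+w. F (\<zeta> * w) \<partial>disc_area) = (\<integral>\<^sup>+w. F (\<zeta> * w) * indicator disc (\<zeta> * w) \<partial>lborel) / pi"
    using nn_integral_disc_area[OF measurable_compose[OF measurable_disc_rotate[OF z] F]]
    by (simp add: indicator_def norm_mult z)
  also have "\<dots> = (\<integral>\<^sup>+w. F w * indicator disc w \<partial>lborel) / pi"
    by (subst lborel_nn_integral_rotate[OF F' z]) simp
  finally show ?thesis
    by (simp add: nn_integral_disc_area[OF F])
qed

section \<open>Radial integrals and moments\<close>

text \<open>The disc of radius \<open>sqrt x\<close> has normalized area \<open>x\<close>, so the
  two distribution functions agree. This gives radial integrals without polar coordinates.\<close>

lemma distr_disc_area_power2: "distr disc_area borel (\<lambda>w. (cmod w)\<^sup>2) = uniform_measure lborel {0..1}"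
proof (rule cdf_unique)
  have m: "(\<lambda>w. (cmod w)\<^sup>2) \<in> borel_measurable disc_area"
    by (rule measurable_disc_areaI) (rule measurable_restrict_space1, measurable)
  interpret prob_space disc_area by (rule prob_space_disc_area)
  show "real_distribution (distr disc_area borel (\<lambda>w. (cmod w)\<^sup>2))"
    by (rule real_distribution_distr[OF m])
  interpret U: prob_space "uniform_measure lborel {0..1::real}"
    by (rule prob_space_uniform_measure) auto
  show "real_distribution (uniform_measure lborel {0..1::real})"
    by standard auto
  show "cdf (distr disc_area borel (\<lambda>w. (cmod w)\<^sup>2)) = cdf (uniform_measure lborel {0..1})"
  proof
    fix x :: real
    have "emeasure (distr disc_area borel (\<lambda>w. (cmod w)\<^sup>2)) {..x} =
        emeasure disc_area ((\<lambda>w. (cmod w)\<^sup>2) -` {..x} \<inter> disc)"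
      by (subst emeasure_distr[OF m]) auto
    also have "\<dots> = (\<integral>\<^sup>+w. indicator ((\<lambda>w. (cmod w)\<^sup>2) -` {..x}) w \<partial>disc_area)"
      by (subst nn_integral_indicator') (use measurable_sets[OF m, of "{..x}"] in auto)
    also have "\<dots> = (\<integral>\<^sup>+w. indicator ((\<lambda>w. (cmod w)\<^sup>2) -` {..x}) w * indicator disc w \<partial>lborel) / pi"
      by (rule nn_integral_disc_area)
        (intro measurable_restrict_space1 borel_measurable_indicator measurable_sets_borel[of _ borel], auto)
    also have "(\<integral>\<^sup>+w. indicator ((\<lambda>w. (cmod w)\<^sup>2) -` {..x}) w * indicator disc w \<partial>lborel) =
       emeasure lborel ((\<lambda>w. (cmod w)\<^sup>2) -` {..x} \<inter> disc)"
    proof (subst nn_integral_indicator[symmetric])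
      have "(\<lambda>w::complex. (cmod w)\<^sup>2) -` {..x} \<in> sets borel"
        by (rule measurable_sets_borel[of _ borel]) auto
      then show "(\<lambda>w. (cmod w)\<^sup>2) -` {..x} \<inter> disc \<in> sets lborel"
        by auto
    qed (intro nn_integral_cong, simp split: split_indicator)
    also have "\<dots> = pi * max 0 (min 1 x)"
    proof -
      consider "x < 0" | "0 \<le> x" "x < 1" | "x \<ge> 1" by linarith
      then show ?thesis
      proof cases
        case 1
        then have "(\<lambda>w. (cmod w)\<^sup>2) -` {..x} \<inter> disc = {}"
          by (auto dest: order_trans[OF zero_le_power2])
        with 1 show ?thesis by simp
      next
        case 2
        have "cmod w < 1" if "(cmod w)\<^sup>2 \<le> x" for w
          using that 2 abs_square_less_1[of "cmod w"] by simp
        then have "(\<lambda>w. (cmod w)\<^sup>2) -` {..x} \<inter> disc = cball 0 (sqrt x)"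
          by (auto simp: real_le_rsqrt sqrt_ge_absD[of "cmod _"] dest: sqrt_ge_absD[of "cmod _"])
        with 2 show ?thesis by (simp add: emeasure_cball unit_ball_vol_2)
      next
        case 3
        have "(cmod w)\<^sup>2 \<le> x" if "cmod w < 1" for w
          using power_le_one[of "cmod w" 2] that 3 by simp
        then have "(\<lambda>w. (cmod w)\<^sup>2) -` {..x} \<inter> disc = disc"
          by auto
        with 3 show ?thesis by (simp add: emeasure_ball unit_ball_vol_2)
      qed
    qed
    also have "\<dots> / pi = max 0 (min 1 x)"
      by (simp add: divide_ennreal)
    also have "ennreal (max 0 (min 1 x)) = emeasure (uniform_measure lborel {0..1}) {..x}"
    proof -
      have *: "{0..1} \<inter> {..x} = {0..min 1 x}" by auto
      have "emeasure lborel {0..min 1 x} = ennreal (max 0 (min 1 x))"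
        by (cases "x < 0") auto
      then show ?thesis by (simp add: * divide_ennreal_def)
    qed
    finally show "cdf (distr disc_area borel (\<lambda>w. (cmod w)\<^sup>2)) x = cdf (uniform_measure lborel {0..1}) x"
      by (simp add: cdf_def measure_def)
  qed
qed

lemma nn_integral_disc_area_radial:
  assumes F[measurable]: "F \<in> borel_measurable borel"
  shows "(\<integral>\<^sup>+w. F ((cmod w)\<^sup>2) \<partial>disc_area) = (\<integral>\<^sup>+x. F x * indicator {0..1} x \<partial>lborel)"
proof -
  have m: "(\<lambda>w. (cmod w)\<^sup>2) \<in> borel_measurable disc_area"
    by (rule measurable_disc_areaI) (rule measurable_restrict_space1, measurable)
  have "(\<integral>\<^sup>+w. F ((cmod w)\<^sup>2) \<partial>disc_area) = (\<integral>\<^sup>+x. F x \<partial>distr disc_area borel (\<lambda>w. (cmod w)\<^sup>2))"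
    by (rule nn_integral_distr[symmetric, OF m]) auto
  then show ?thesis
    by (simp add: distr_disc_area_power2 nn_integral_uniform_measure divide_ennreal_def)
qed

lemma nn_integral_disc_area_moment:
  "(\<integral>\<^sup>+w. ennreal (((cmod w)\<^sup>2) ^ n) \<partial>disc_area) = ennreal (1 / (n + 1))"
proof -
  have "(\<integral>\<^sup>+x. ennreal (x ^ n) * indicator {0..1} x \<partial>lborel) = ennreal (1 ^ Suc n / Suc n - 0 ^ Suc n / Suc n)"
    by (rule nn_integral_FTC_Icc[where F = "\<lambda>x. x ^ Suc n / Suc n"])
      (auto intro!: derivative_eq_intros simp del: of_nat_Suc power_Suc)
  then show ?thesis
    by (subst nn_integral_disc_area_radial[of "\<lambda>x. ennreal (x ^ n)"]) (auto simp: add_ac)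
qed

text \<open>The factor 1 - |w|^2 is what remains of (1 - |w|^2)^2 in the oscillation series after
  multiplication by the weight 1/(1 - |w|^2).\<close>

lemma nn_integral_disc_area_moment2:
  "(\<integral>\<^sup>+w. ennreal ((1 - (cmod w)\<^sup>2) * ((cmod w)\<^sup>2) ^ n) \<partial>disc_area) =
     ennreal (1 / (real (n + 1) * real (n + 2)))"
proof -
  have "(\<integral>\<^sup>+x. ennreal ((1 - x) * x ^ n) * indicator {0..1} x \<partial>lborel) =
      ennreal ((1 ^ Suc n / Suc n - 1 ^ (n + 2) / real (n + 2)) - (0 ^ Suc n / Suc n - 0 ^ (n + 2) / real (n + 2)))"
    by (rule nn_integral_FTC_Icc[where F = "\<lambda>x. x ^ Suc n / Suc n - x ^ (n + 2) / real (n + 2)"])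
      (auto intro!: derivative_eq_intros simp: left_diff_distrib simp del: of_nat_Suc of_nat_add power_Suc,
       auto simp: mult_left_le_one_le)
  also have "((1 ^ Suc n / Suc n - 1 ^ (n + 2) / real (n + 2)) - (0 ^ Suc n / Suc n - 0 ^ (n + 2) / real (n + 2))) =
      1 / (real (n + 1) * real (n + 2))"
    by (simp add: divide_simps)
  finally show ?thesis
    by (subst nn_integral_disc_area_radial[of "\<lambda>x. ennreal ((1 - x) * x ^ n)"]) auto
qed

subsection \<open>Arc length and power series on circles\<close>

lemma measurable_circle_id: "(\<lambda>\<zeta>. \<zeta>) \<in> circle_arc_length \<rightarrow>\<^sub>M borel"
  by (simp add: circle_arc_length_def measurable_restrict_space1 cong: measurable_cong_sets)

lemma measurable_cis: "cis \<in> restrict_space lborel {0..<2*pi} \<rightarrow>\<^sub>M restrict_space borel (sphere 0 1)"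
proof -
  have "cis \<in> borel \<rightarrow>\<^sub>M borel"
    by (intro borel_measurable_continuous_onI continuous_intros)
  then have "cis \<in> restrict_space borel {0..<2*pi} \<rightarrow>\<^sub>M restrict_space borel (sphere 0 1)"
    by (rule measurable_restrict_space3) auto
  then show ?thesis
    by (simp add: sets_restrict_space cong: measurable_cong_sets)
qed

lemma space_circle [simp]: "space circle_arc_length = sphere 0 1"
  by (simp add: circle_arc_length_def space_restrict_space)

lemma nn_integral_circle:
  assumes F[measurable]: "F \<in> borel_measurable borel"
  shows "(\<integral>\<^sup>+\<zeta>. F \<zeta> \<partial>circle_arc_length) = (\<integral>\<^sup>+\<theta>. F (cis \<theta>) * indicator {0..<2*pi} \<theta> \<partial>lborel)"
  unfolding circle_arc_length_def
  by (subst nn_integral_distr[OF measurable_cis])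
     (auto simp: nn_integral_restrict_space intro: measurable_restrict_space1)

lemma emeasure_circle_space: "emeasure circle_arc_length (sphere 0 1) = ennreal (2 * pi)"
proof -
  have "emeasure circle_arc_length (sphere 0 1) = (\<integral>\<^sup>+\<zeta>. 1 \<partial>circle_arc_length)"
    by simp
  also have "\<dots> = ennreal (2 * pi)"
    by (subst nn_integral_circle) auto
  finally show ?thesis .
qed

lemma finite_measure_circle: "finite_measure circle_arc_length"
  by (rule finite_measureI) (simp add: emeasure_circle_space)

text \<open>The half-open parameter interval is exchanged for the closed one, to which the
  fundamental theorem of calculus applies; the endpoint is a null set.\<close>

lemma integral_circle:
  fixes F :: "complex \<Rightarrow> complex"
  assumes F[measurable]: "F \<in> borel_measurable borel"
  shows "(\<integral>\<zeta>. F \<zeta> \<partial>circle_arc_length) = (\<integral>\<theta>. indicator {0..2*pi} \<theta> *\<^sub>R F (cis \<theta>) \<partial>lborel)"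
proof -
  have [measurable]: "cis \<in> borel \<rightarrow>\<^sub>M borel"
    by (intro borel_measurable_continuous_onI continuous_intros)
  have "(\<integral>\<zeta>. F \<zeta> \<partial>circle_arc_length) = (\<integral>\<theta>. indicator {0..<2*pi} \<theta> *\<^sub>R F (cis \<theta>) \<partial>lborel)"
    unfolding circle_arc_length_def
    by (subst integral_distr[OF measurable_cis])
       (auto simp: integral_restrict_space intro: measurable_restrict_space1)
  also have "\<dots> = (\<integral>\<theta>. indicator {0..2*pi} \<theta> *\<^sub>R F (cis \<theta>) \<partial>lborel)"
  proof (rule integral_cong_AE)
    show "AE \<theta> in lborel. indicator {0..<2*pi} \<theta> *\<^sub>R F (cis \<theta>) = indicator {0..2*pi} \<theta> *\<^sub>R F (cis \<theta>)"
      using AE_lborel_singleton[of "2*pi"] by eventually_elim (auto simp: indicator_def)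
  qed measurable
  finally show ?thesis .
qed

lemma integral_circle_orthogonal:
  "(\<integral>\<zeta>. \<zeta> ^ n * cnj \<zeta> ^ m \<partial>circle_arc_length) = (if n = m then 2 * pi else 0)"
proof -
  \<comment> \<open>The frequency is a real number, since \<open>n - m\<close> would be truncated at
    0.\<close>
  define k where "k = real n - real m"
  have m: "(\<lambda>\<zeta>::complex. \<zeta> ^ n * cnj \<zeta> ^ m) \<in> borel_measurable borel"
    by (intro borel_measurable_continuous_onI continuous_intros)
  have cis: "cis \<theta> ^ n * cnj (cis \<theta>) ^ m = cis (k * \<theta>)" for \<theta>
    by (simp add: Complex.DeMoivre cis_cnj cis_mult k_def algebra_simps)
  have eq: "(\<integral>\<zeta>. \<zeta> ^ n * cnj \<zeta> ^ m \<partial>circle_arc_length) = (\<integral>\<theta>. indicator {0..2*pi} \<theta> *\<^sub>R cis (k * \<theta>) \<partial>lborel)"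
    by (subst integral_circle[OF m]) (simp only: cis)
  show ?thesis
  proof (cases "n = m")
    case True
    then show ?thesis unfolding eq by (simp add: k_def scaleR_conv_of_real)
  next
    case False
    then have k: "k \<noteq> 0" by (simp add: k_def)
    have "(\<integral>\<theta>. indicator {0..2*pi} \<theta> *\<^sub>R cis (k * \<theta>) \<partial>lborel) =
        cis (k * (2*pi)) / (\<i> * k) - cis (k * 0) / (\<i> * k)"
    proof (rule integral_FTC_Icc)
      show "((\<lambda>\<theta>. cis (k * \<theta>) / (\<i> * k)) has_vector_derivative cis (k * x)) (at x within {0..2*pi})" for x
      proof -
        have "((\<lambda>z. exp (\<i> * k * z) / (\<i> * k)) has_field_derivative exp (\<i> * k * of_real x)) (at (of_real x))"
          using k by (auto intro!: derivative_eq_intros)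
        from has_vector_derivative_real_field[OF this] show ?thesis
          by (simp add: cis_conv_exp mult_ac)
      qed
      show "continuous_on {0..2*pi} (\<lambda>x. cis (k * x))"
        by (intro continuous_intros)
    qed simp
    also have "cis (k * (2*pi)) = 1"
    proof -
      have "k * (2*pi) = 2 * pi * of_int (int n - int m)" by (simp add: k_def)
      then show ?thesis by (simp only: cis_multiple_2pi Ints_of_int)
    qed
    finally show ?thesis unfolding eq using False by simp
  qed
qed

section \<open>Arc length of the circle inside a ball\<close>

text \<open>A weak Jordan inequality. The mean value theorem gives sin y \<ge> y cos y at y = x/2;
  doubling the angle yields sin x \<ge> x cos^2(x/2) = x (1 + cos x)/2, and cos x \<ge> 0 in this
  range.\<close>

lemma half_abs_le_abs_sin:
  fixes x :: real
  assumes "\<bar>x\<bar> \<le> pi / 2"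
  shows "\<bar>x\<bar> / 2 \<le> \<bar>sin x\<bar>"
proof -
  have *: "x / 2 \<le> sin x" if x: "0 \<le> x" "x \<le> pi / 2" for x
  proof (cases "x = 0")
    case False
    with x have "0 < x / 2" by simp
    from MVT2[OF this, of sin cos] obtain c where c: "0 < c" "c < x / 2" "sin (x / 2) = x / 2 * cos c"
      by auto
    have "cos (x / 2) \<le> cos c"
      using c x by (intro cos_monotone_0_pi_le) auto
    then have "x / 2 * cos (x / 2) \<le> sin (x / 2)"
      unfolding c(3) using x by (intro mult_left_mono) auto
    moreover have "0 \<le> cos (x / 2)"
      using x by (intro cos_ge_zero) auto
    ultimately have "2 * (x / 2 * cos (x / 2)) * cos (x / 2) \<le> 2 * sin (x / 2) * cos (x / 2)"
      by (intro mult_right_mono) auto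
    also have "2 * sin (x / 2) * cos (x / 2) = sin x"
      using sin_double[of "x / 2"] by simp
    also have "2 * (x / 2 * cos (x / 2)) * cos (x / 2) = x * (1 + cos x) / 2"
      using cos_double_cos[of "x / 2"] by (simp add: power2_eq_square algebra_simps)
    finally have "x * (1 + cos x) / 2 \<le> sin x" .
    moreover have "x * 1 \<le> x * (1 + cos x)"
      using x cos_ge_zero[of x] by (intro mult_left_mono) auto
    ultimately show ?thesis by simp
  qed simp
  show ?thesis
    using *[of x] *[of "- x"] assms by (cases "x \<ge> 0") auto
qed

lemma norm_cis_diff: "cmod (cis s - cis t) = 2 * \<bar>sin ((s - t) / 2)\<bar>"
proof -
  have "(cmod (cis s - cis t))\<^sup>2 = (cos s - cos t)\<^sup>2 + (sin s - sin t)\<^sup>2"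
    by (simp add: cmod_power2)
  also have "\<dots> = ((sin s)\<^sup>2 + (cos s)\<^sup>2) + ((sin t)\<^sup>2 + (cos t)\<^sup>2) - 2 * (cos s * cos t + sin s * sin t)"
    by (simp add: power2_eq_square algebra_simps)
  also have "\<dots> = 2 - 2 * cos (s - t)"
    by (simp add: cos_diff)
  also have "\<dots> = 2 - 2 * cos (2 * ((s - t) / 2))"
    by (simp only: nonzero_mult_div_cancel_left times_divide_eq_right)
  also have "\<dots> = (2 * \<bar>sin ((s - t) / 2)\<bar>)\<^sup>2"
    by (subst cos_double_sin) (simp add: power_mult_distrib)
  finally show ?thesis
    by (rule power2_eq_imp_eq) auto
qed

text \<open>Two points of the circle in the ball are less than 2e apart, so their angles differ by
  less than 4e modulo 2 pi. As the parameter is cut at 0, the arc may wrap around, whence three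
  intervals of length 8e and the constant 24.\<close>

lemma nn_integral_circle_ball:
  assumes e: "e > 0"
  shows "(\<integral>\<^sup>+\<zeta>. indicator (ball z e) \<zeta> \<partial>circle_arc_length) \<le> ennreal (24 * e)"
proof -
  define S where "S = {\<theta>\<in>{0..<2*pi}. cis \<theta> \<in> ball z e}"
  have eq: "(\<integral>\<^sup>+\<zeta>. indicator (ball z e) \<zeta> \<partial>circle_arc_length) = (\<integral>\<^sup>+\<theta>. indicator S \<theta> \<partial>lborel)"
    by (subst nn_integral_circle)
      (auto intro!: nn_integral_cong borel_measurable_indicator simp: S_def indicator_def)
  show ?thesis
  proof (cases "S = {}")
    case False
    then obtain t where t: "t \<in> S" by auto
    define I where "I c = {c - 4 * e..c + 4 * e}" for c
    have "S \<subseteq> I t \<union> (I (t + 2*pi) \<union> I (t - 2*pi))"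
    proof
      fix s assume s: "s \<in> S"
      have "dist (cis s) (cis t) < 2 * e"
        using s t dist_triangle_half_l[of "cis s" z "2 * e" "cis t"] by (simp add: S_def dist_commute)
      then have d: "\<bar>sin ((s - t) / 2)\<bar> < e"
        by (simp add: dist_norm norm_cis_diff)
      have st: "\<bar>s - t\<bar> < 2 * pi"
        using s t by (auto simp: S_def)
      consider "\<bar>s - t\<bar> \<le> pi" | "s - t > pi" | "t - s > pi" by linarith
      then show "s \<in> I t \<union> (I (t + 2*pi) \<union> I (t - 2*pi))"
      proof cases
        case 1
        then show ?thesis
          using half_abs_le_abs_sin[of "(s - t) / 2"] d by (auto simp: I_def)
      next
        case 2
        have "sin ((s - t) / 2) = sin (pi - (s - t) / 2)" by simp
        also have "\<dots> = - sin ((s - t - 2*pi) / 2)"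
          by (subst sin_minus[symmetric], rule arg_cong[of _ _ sin]) (simp add: field_simps)
        finally have "\<bar>sin ((s - t - 2*pi) / 2)\<bar> < e" using d by simp
        moreover have "\<bar>(s - t - 2*pi) / 2\<bar> \<le> pi / 2" using 2 st by (auto simp: abs_le_iff abs_less_iff field_simps)
        ultimately show ?thesis
          using half_abs_le_abs_sin[of "(s - t - 2*pi) / 2"] 2 e by (auto simp: I_def)
      next
        case 3
        have "sin ((s - t) / 2) = - sin ((s - t + 2*pi) / 2)"
          using sin_periodic_pi[of "(s - t) / 2"] by (simp add: add_divide_distrib)
        then have "\<bar>sin ((s - t + 2*pi) / 2)\<bar> < e" using d by simp
        moreover have "\<bar>(s - t + 2*pi) / 2\<bar> \<le> pi / 2" using 3 st by (auto simp: abs_le_iff abs_less_iff field_simps)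
        ultimately show ?thesis
          using half_abs_le_abs_sin[of "(s - t + 2*pi) / 2"] 3 e pi_gt_zero by (auto simp: I_def simp del: pi_gt_zero)
      qed
    qed
    then have "(\<integral>\<^sup>+\<theta>. indicator S \<theta> \<partial>lborel) \<le> (\<integral>\<^sup>+\<theta>. indicator (I t \<union> (I (t + 2*pi) \<union> I (t - 2*pi))) \<theta> \<partial>lborel)"
      by (intro nn_integral_mono) (auto simp: indicator_def)
    also have "\<dots> = emeasure lborel (I t \<union> (I (t + 2*pi) \<union> I (t - 2*pi)))"
      by (rule nn_integral_indicator) (auto simp: I_def)
    also have "\<dots> \<le> emeasure lborel (I t) + (emeasure lborel (I (t + 2*pi)) + emeasure lborel (I (t - 2*pi)))"
      by (intro order.trans[OF emeasure_subadditive] add_left_mono) (auto simp: I_def)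
    also have "\<dots> = ennreal (24 * e)"
      using e by (simp add: I_def flip: ennreal_plus)
    finally show ?thesis by (simp add: eq)
  qed (simp add: eq)
qed

section \<open>Power series and Parseval's identity\<close>

definition has_coeffs :: "(complex \<Rightarrow> complex) \<Rightarrow> (nat \<Rightarrow> complex) \<Rightarrow> bool" where
  "has_coeffs f a \<longleftrightarrow> (\<forall>w\<in>disc. (\<lambda>n. a n * w ^ n) sums f w)"

lemma has_coeffs_holomorphic: "has_coeffs f a \<Longrightarrow> f holomorphic_on disc"
  by (rule power_series_holomorphic[of _ _ a]) (auto simp: has_coeffs_def)

lemma holomorphic_has_coeffs: "f holomorphic_on disc \<Longrightarrow> \<exists>a. has_coeffs f a"
  using holomorphic_power_series[of f 0 1] unfolding has_coeffs_def
  by (intro exI[of _ "\<lambda>n. (deriv ^^ n) f 0 / fact n"]) simp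

lemma has_coeffs_abs_summable:
  assumes f: "has_coeffs f a" and w: "w \<in> disc"
  shows "summable (\<lambda>n. cmod (a n * w ^ n))"
proof -
  obtain r where r: "cmod w < r" "r < 1" using w dense by auto
  then have "complex_of_real r \<in> disc"
    using norm_ge_zero[of w] by (auto simp del: norm_ge_zero)
  then have "summable (\<lambda>n. a n * complex_of_real r ^ n)"
    using f by (auto simp: has_coeffs_def sums_iff)
  then show ?thesis
    by (rule powser_insidea) (use r norm_ge_zero[of w] in auto)
qed

text \<open>The polarized form is needed because the reproducing property pairs a function with the
  kernel. Orthogonality settles the partial sums, which are dominated on the whole circle by the
  product of the two absolute series at \<open>w\<close>.\<close>

lemma circle_parseval:
  assumes ga: "has_coeffs g a" and hb: "has_coeffs h b" and w: "w \<in> disc"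
  shows "(\<lambda>n. 2 * pi * (a n * cnj (b n) * ((cmod w)\<^sup>2) ^ n)) sums
           (\<integral>\<zeta>. g (\<zeta> * w) * cnj (h (\<zeta> * w)) \<partial>circle_arc_length)"
proof -
  interpret finite_measure circle_arc_length by (rule finite_measure_circle)
  note [measurable] = measurable_circle_id
  define p where "p a N \<zeta> = (\<Sum>n<N. a n * (\<zeta> * w) ^ n)" for a :: "nat \<Rightarrow> complex" and N \<zeta>
  define A where "A a = (\<Sum>n. cmod (a n * w ^ n))" for a :: "nat \<Rightarrow> complex"
  note g = has_coeffs_holomorphic[OF ga] and h = has_coeffs_holomorphic[OF hb]
  have lim: "(\<lambda>N. p a N \<zeta>) \<longlonglongrightarrow> f (\<zeta> * w)" if "has_coeffs f a" "\<zeta> \<in> sphere 0 1" for f a \<zeta>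
    using that w unfolding has_coeffs_def sums_def p_def by (simp add: norm_mult)
  have bd: "cmod (p a N \<zeta>) \<le> A a" if "has_coeffs f a" "\<zeta> \<in> sphere 0 1" for f a N \<zeta>
  proof -
    have "cmod (p a N \<zeta>) \<le> (\<Sum>n<N. cmod (a n * w ^ n))"
      unfolding p_def using that(2)
      by (intro order.trans[OF norm_sum] sum_mono) (simp add: norm_mult norm_power power_mult_distrib)
    also have "\<dots> \<le> A a"
      unfolding A_def by (rule sum_le_suminf[OF has_coeffs_abs_summable[OF that(1) w]]) auto
    finally show ?thesis .
  qed
  have int: "(\<lambda>N. \<integral>\<zeta>. p a N \<zeta> * cnj (p b N \<zeta>) \<partial>circle_arc_length) \<longlonglongrightarrow>
      (\<integral>\<zeta>. g (\<zeta> * w) * cnj (h (\<zeta> * w)) \<partial>circle_arc_length)"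
  proof (rule integral_dominated_convergence[where w = "\<lambda>_. A a * A b"])
    have c: "(\<lambda>\<zeta>. g (\<zeta> * w) * cnj (h (\<zeta> * w))) \<in> borel_measurable (restrict_space borel (sphere 0 1))"
    proof (rule borel_measurable_continuous_on_restrict)
      have "continuous_on (sphere 0 1) (\<lambda>\<zeta>. f (\<zeta> * w))" if "f holomorphic_on disc" for f
        using w by (intro continuous_on_compose2[OF holomorphic_on_imp_continuous_on[OF that]] continuous_intros)
          (auto simp: norm_mult)
      then show "continuous_on (sphere 0 1) (\<lambda>\<zeta>. g (\<zeta> * w) * cnj (h (\<zeta> * w)))"
        using g h by (intro continuous_intros)
    qed
    then show "(\<lambda>\<zeta>. g (\<zeta> * w) * cnj (h (\<zeta> * w))) \<in> borel_measurable circle_arc_length"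
      by (simp add: circle_arc_length_def cong: measurable_cong_sets)
    show "(\<lambda>\<zeta>. p a N \<zeta> * cnj (p b N \<zeta>)) \<in> borel_measurable circle_arc_length" for N
      by (rule measurable_compose[OF measurable_circle_id])
        (unfold p_def, intro borel_measurable_continuous_onI continuous_intros)
    show "AE \<zeta> in circle_arc_length. (\<lambda>N. p a N \<zeta> * cnj (p b N \<zeta>)) \<longlonglongrightarrow> g (\<zeta> * w) * cnj (h (\<zeta> * w))"
      by (intro AE_I2 tendsto_intros lim[OF ga] lim[OF hb]) simp_all
    show "AE \<zeta> in circle_arc_length. cmod (p a N \<zeta> * cnj (p b N \<zeta>)) \<le> A a * A b" for N
      using bd[OF ga] bd[OF hb] by (intro AE_I2) (auto simp: norm_mult intro!: mult_mono')
  qed simp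
  have "(\<integral>\<zeta>. p a N \<zeta> * cnj (p b N \<zeta>) \<partial>circle_arc_length) =
      (\<Sum>n<N. 2 * pi * (a n * cnj (b n) * ((cmod w)\<^sup>2) ^ n))" for N
  proof -
    have i: "integrable circle_arc_length (\<lambda>\<zeta>. c * (\<zeta> ^ n * cnj \<zeta> ^ m))" for c n m
    proof (rule integrable_const_bound[where B = "cmod c"])
      show "(\<lambda>\<zeta>. c * (\<zeta> ^ n * cnj \<zeta> ^ m)) \<in> borel_measurable circle_arc_length"
        by (rule measurable_compose[OF measurable_circle_id])
          (intro borel_measurable_continuous_onI continuous_intros)
    qed (auto simp: norm_mult norm_power intro!: AE_I2)
    have "(\<integral>\<zeta>. p a N \<zeta> * cnj (p b N \<zeta>) \<partial>circle_arc_length) =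
      (\<integral>\<zeta>. (\<Sum>n<N. \<Sum>m<N. (a n * w ^ n * cnj (b m * w ^ m)) * (\<zeta> ^ n * cnj \<zeta> ^ m)) \<partial>circle_arc_length)"
      by (simp add: p_def sum_product power_mult_distrib mult_ac)
    also have "\<dots> = (\<Sum>n<N. \<Sum>m<N. (a n * w ^ n * cnj (b m * w ^ m)) * (if n = m then 2 * pi else 0))"
      using i by (simp add: Bochner_Integration.integral_sum Bochner_Integration.integrable_sum integral_circle_orthogonal del: of_real_mult)
    also have "\<dots> = (\<Sum>n<N. (a n * w ^ n * cnj (b n * w ^ n)) * (2 * pi))"
      by (intro sum.cong refl) (simp add: if_distrib cong: if_cong)
    also have "\<dots> = (\<Sum>n<N. 2 * pi * (a n * cnj (b n) * ((cmod w)\<^sup>2) ^ n))"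
    proof (intro sum.cong refl)
      fix n
      have "complex_of_real (((cmod w)\<^sup>2) ^ n) = w ^ n * cnj w ^ n"
        by (metis complex_norm_square of_real_power power_mult_distrib)
      then show "(a n * w ^ n * cnj (b n * w ^ n)) * (2 * pi) =
          2 * pi * (a n * cnj (b n) * ((cmod w)\<^sup>2) ^ n)"
        by (simp add: mult_ac)
    qed
    finally show ?thesis .
  qed
  with int show ?thesis
    unfolding sums_def by simp
qed

text \<open>The diagonal case in \<open>ennreal\<close>, where all later interchanges of sums and
  integrals rest on nonnegativity and measurability alone.\<close>

lemma circle_parseval_norm:
  assumes ga: "has_coeffs g a" and w: "w \<in> disc"
  shows "(\<integral>\<^sup>+\<zeta>. ennreal ((cmod (g (\<zeta> * w)))\<^sup>2) \<partial>circle_arc_length) =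
           (\<Sum>n. ennreal (2 * pi * ((cmod (a n))\<^sup>2 * ((cmod w)\<^sup>2) ^ n)))"
proof -
  interpret finite_measure circle_arc_length by (rule finite_measure_circle)
  have c: "continuous_on (sphere 0 1) (\<lambda>\<zeta>. g (\<zeta> * w))"
    using w by (intro continuous_on_compose2[OF holomorphic_on_imp_continuous_on[OF has_coeffs_holomorphic[OF ga]]]
      continuous_intros) (auto simp: norm_mult)
  then have "bounded ((\<lambda>\<zeta>. g (\<zeta> * w)) ` sphere 0 1)"
    by (intro compact_imp_bounded compact_continuous_image) simp_all
  then obtain B where B: "\<And>\<zeta>. \<zeta> \<in> sphere 0 1 \<Longrightarrow> cmod (g (\<zeta> * w)) \<le> B"
    unfolding bounded_iff by (metis imageI)
  have m: "(\<lambda>\<zeta>. g (\<zeta> * w)) \<in> borel_measurable circle_arc_length"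
    using borel_measurable_continuous_on_restrict[OF c]
    by (simp add: circle_arc_length_def cong: measurable_cong_sets)
  have int: "integrable circle_arc_length (\<lambda>\<zeta>. (cmod (g (\<zeta> * w)))\<^sup>2)"
    by (rule integrable_const_bound[where B = "B\<^sup>2"])
      (use m in \<open>auto intro!: AE_I2 power_mono B simp: dist_norm\<close>)
  have cn: "z * cnj z = complex_of_real ((cmod z)\<^sup>2)" for z
    by (rule complex_norm_square[symmetric])
  have "(\<lambda>n. complex_of_real (2 * pi * ((cmod (a n))\<^sup>2 * ((cmod w)\<^sup>2) ^ n))) sums
          (\<integral>\<zeta>. complex_of_real ((cmod (g (\<zeta> * w)))\<^sup>2) \<partial>circle_arc_length)"
    using circle_parseval[OF ga ga w] unfolding cn by simp
  then have "(\<lambda>n. complex_of_real (2 * pi * ((cmod (a n))\<^sup>2 * ((cmod w)\<^sup>2) ^ n))) sums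
          of_real (\<integral>\<zeta>. (cmod (g (\<zeta> * w)))\<^sup>2 \<partial>circle_arc_length)"
    by (simp only: integral_complex_of_real)
  then have s: "(\<lambda>n. 2 * pi * ((cmod (a n))\<^sup>2 * ((cmod w)\<^sup>2) ^ n)) sums
          (\<integral>\<zeta>. (cmod (g (\<zeta> * w)))\<^sup>2 \<partial>circle_arc_length)"
    by (simp only: sums_of_real_iff)
  have "(\<integral>\<^sup>+\<zeta>. ennreal ((cmod (g (\<zeta> * w)))\<^sup>2) \<partial>circle_arc_length) =
      ennreal (\<integral>\<zeta>. (cmod (g (\<zeta> * w)))\<^sup>2 \<partial>circle_arc_length)"
    by (rule nn_integral_eq_integral[OF int]) simp
  also have "\<dots> = (\<Sum>n. ennreal (2 * pi * ((cmod (a n))\<^sup>2 * ((cmod w)\<^sup>2) ^ n)))"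
    using s by (intro suminf_ennreal_eq[symmetric]) auto
  finally show ?thesis .
qed

subsection \<open>The reproducing property\<close>

lemma measurable_disc_area_id: "(\<lambda>w. w) \<in> disc_area \<rightarrow>\<^sub>M borel"
  by (rule measurable_disc_areaI) (simp add: measurable_restrict_space1)

lemma measurable_disc_times_circle:
  "(\<lambda>(w, \<zeta>). \<zeta> * w) \<in> disc_area \<Otimes>\<^sub>M circle_arc_length \<rightarrow>\<^sub>M restrict_space borel disc"
proof (rule measurable_restrict_space2)
  show "(\<lambda>(w, \<zeta>). \<zeta> * w) \<in> space (disc_area \<Otimes>\<^sub>M circle_arc_length) \<rightarrow> disc"
    by (auto simp: space_pair_measure norm_mult)
  have [measurable]: "fst \<in> borel_measurable (disc_area \<Otimes>\<^sub>M circle_arc_length)"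
    "snd \<in> borel_measurable (disc_area \<Otimes>\<^sub>M circle_arc_length)"
    using measurable_compose[OF measurable_fst measurable_disc_area_id]
      measurable_compose[OF measurable_snd measurable_circle_id] by auto
  show "(\<lambda>(w, \<zeta>). \<zeta> * w) \<in> borel_measurable (disc_area \<Otimes>\<^sub>M circle_arc_length)"
    unfolding case_prod_beta by measurable
qed

lemma pair_sigma_finite_disc_circle: "pair_sigma_finite disc_area circle_arc_length"
proof -
  interpret prob_space disc_area by (rule prob_space_disc_area)
  interpret C: finite_measure circle_arc_length by (rule finite_measure_circle)
  show ?thesis ..
qed

text \<open>Rotation invariance makes the inner area integral independent of \<zeta>, so averaging
  the integrand over rotations costs only the factor 2 pi. Parseval's identity then applies on each
  circle.\<close>

lemma nn_integral_disc_area_average: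
  fixes F :: "complex \<Rightarrow> ennreal"
  assumes F: "F \<in> borel_measurable (restrict_space borel disc)"
  shows "(\<integral>\<^sup>+w. \<integral>\<^sup>+\<zeta>. F (\<zeta> * w) \<partial>circle_arc_length \<partial>disc_area) = ennreal (2 * pi) * (\<integral>\<^sup>+w. F w \<partial>disc_area)"
proof -
  interpret pair_sigma_finite disc_area circle_arc_length by (rule pair_sigma_finite_disc_circle)
  have "(\<integral>\<^sup>+w. \<integral>\<^sup>+\<zeta>. F (\<zeta> * w) \<partial>circle_arc_length \<partial>disc_area) =
      (\<integral>\<^sup>+\<zeta>. \<integral>\<^sup>+w. F (\<zeta> * w) \<partial>disc_area \<partial>circle_arc_length)"
    by (rule Fubini'[symmetric])
       (use measurable_compose[OF measurable_disc_times_circle F] in \<open>simp add: case_prod_beta\<close>)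
  also have "\<dots> = (\<integral>\<^sup>+\<zeta>. (\<integral>\<^sup>+w. F w \<partial>disc_area) \<partial>circle_arc_length)"
    by (intro nn_integral_cong nn_integral_disc_area_rotate F) simp
  finally show ?thesis
    by (simp add: emeasure_circle_space mult.commute)
qed

lemma integral_disc_area_rotate:
  fixes F :: "complex \<Rightarrow> complex"
  assumes F: "F \<in> borel_measurable (restrict_space borel disc)" and z: "cmod \<zeta> = 1"
  shows "(\<integral>w. F (\<zeta> * w) \<partial>disc_area) = (\<integral>w. F w \<partial>disc_area)"
proof -
  let ?B = "restrict_space borel disc :: complex measure"
  have rot: "(\<lambda>w. \<zeta> * w) \<in> disc_area \<rightarrow>\<^sub>M ?B"
    by (rule measurable_disc_areaI[OF measurable_disc_rotate[OF z]])
  \<comment> \<open>Equality of the image measures carries the invariance from nonnegative to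
    complex integrands.\<close>
  have "distr disc_area ?B (\<lambda>w. \<zeta> * w) = distr disc_area ?B (\<lambda>w. w)"
  proof (rule measure_eqI)
    fix A assume "A \<in> sets (distr disc_area ?B (\<lambda>w. \<zeta> * w))"
    then have A: "A \<in> sets ?B" by simp
    have "emeasure (distr disc_area ?B h) A = (\<integral>\<^sup>+w. indicator A (h w) \<partial>disc_area)"
      if h: "h \<in> disc_area \<rightarrow>\<^sub>M ?B" for h
      using A h by (subst nn_integral_indicator[symmetric], simp, subst nn_integral_distr) auto
    from this[OF rot] this[OF measurable_disc_area_borel]
    show "emeasure (distr disc_area ?B (\<lambda>w. \<zeta> * w)) A = emeasure (distr disc_area ?B (\<lambda>w. w)) A"
      using nn_integral_disc_area_rotate[of "indicator A", OF _ z] A by simp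
  qed simp
  then have "(\<integral>w. F w \<partial>distr disc_area ?B (\<lambda>w. \<zeta> * w)) = (\<integral>w. F w \<partial>distr disc_area ?B (\<lambda>w. w))"
    by simp
  then show ?thesis
    by (simp add: integral_distr[OF rot F] integral_distr[OF measurable_disc_area_borel F])
qed

lemma integral_disc_area_average:
  fixes F :: "complex \<Rightarrow> complex"
  assumes F: "continuous_on disc F" and B: "\<And>w. w \<in> disc \<Longrightarrow> cmod (F w) \<le> B"
  shows "(\<integral>w. \<integral>\<zeta>. F (\<zeta> * w) \<partial>circle_arc_length \<partial>disc_area) = 2 * pi * (\<integral>w. F w \<partial>disc_area)"
proof -
  interpret D: prob_space disc_area by (rule prob_space_disc_area)
  interpret C: finite_measure circle_arc_length by (rule finite_measure_circle)
  interpret pair_sigma_finite disc_area circle_arc_length ..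
  interpret P: pair_sigma_finite circle_arc_length disc_area ..
  interpret fm: finite_measure "disc_area \<Otimes>\<^sub>M circle_arc_length"
    by (rule finite_measure_pair_measure) unfold_locales
  have Fm: "F \<in> borel_measurable (restrict_space borel disc)"
    by (rule borel_measurable_continuous_on_restrict[OF F])
  have "(\<integral>w. \<integral>\<zeta>. F (\<zeta> * w) \<partial>circle_arc_length \<partial>disc_area) =
      (\<integral>\<zeta>. \<integral>w. F (\<zeta> * w) \<partial>disc_area \<partial>circle_arc_length)"
  proof (rule Fubini_integral[symmetric], rule fm.integrable_const_bound[where B = B])
    show "(\<lambda>(w, \<zeta>). F (\<zeta> * w)) \<in> borel_measurable (disc_area \<Otimes>\<^sub>M circle_arc_length)"
      using measurable_compose[OF measurable_disc_times_circle Fm] by (simp add: case_prod_beta)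
  qed (auto simp: space_pair_measure norm_mult intro!: AE_I2 B)
  also have "\<dots> = (\<integral>\<zeta>. (\<integral>w. F w \<partial>disc_area) \<partial>circle_arc_length)"
    by (intro Bochner_Integration.integral_cong refl integral_disc_area_rotate Fm) simp
  also have "\<dots> = 2 * pi * (\<integral>w. F w \<partial>disc_area)"
    by (simp add: measure_def emeasure_circle_space scaleR_conv_of_real)
  finally show ?thesis .
qed

text \<open>The Bergman kernel without normalization. It is a square root in the sense that the
  density |k_z|^2 is its squared modulus times (1 - |z|^2)^2.\<close>

definition kernel_sqrt :: "complex \<Rightarrow> complex \<Rightarrow> complex" where
  "kernel_sqrt z w = 1 / (1 - cnj z * w)\<^sup>2"

lemma one_minus_cnj_mult_ge:
  assumes "z \<in> disc" "w \<in> disc"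
  shows "1 - cmod z \<le> cmod (1 - cnj z * w)" "1 - cnj z * w \<noteq> 0"
proof -
  have "cmod (cnj z * w) \<le> cmod z * 1"
    unfolding norm_mult complex_mod_cnj using assms by (intro mult_left_mono) auto
  then show "1 - cmod z \<le> cmod (1 - cnj z * w)"
    using norm_triangle_ineq2[of 1 "cnj z * w"] by simp
  with assms show "1 - cnj z * w \<noteq> 0" by auto
qed

lemma holomorphic_kernel_sqrt: "z \<in> disc \<Longrightarrow> kernel_sqrt z holomorphic_on disc"
  unfolding kernel_sqrt_def by (intro holomorphic_intros) (use one_minus_cnj_mult_ge in auto)

lemma norm_kernel_sqrt_le:
  assumes "z \<in> disc" "w \<in> disc"
  shows "cmod (kernel_sqrt z w) \<le> 1 / (1 - cmod z)\<^sup>2"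
  unfolding kernel_sqrt_def norm_divide norm_power norm_one
  using one_minus_cnj_mult_ge[OF assms] assms by (intro frac_le power_mono) auto

lemma kernel_sqrt_coeffs:
  assumes z: "z \<in> disc"
  shows "has_coeffs (kernel_sqrt z) (\<lambda>n. of_nat (n + 1) * cnj z ^ n)"
  unfolding has_coeffs_def
proof
  fix w assume w: "w \<in> disc"
  have "cmod (cnj z * w) < 1 * 1"
    unfolding norm_mult using z w by (intro mult_strict_mono') auto
  then have "(\<lambda>n. of_nat (Suc n) * (cnj z * w) ^ n) sums (1 / (1 - cnj z * w)\<^sup>2)"
    by (intro geometric_deriv_sums) simp
  then show "(\<lambda>n. of_nat (n + 1) * cnj z ^ n * w ^ n) sums kernel_sqrt z w"
    by (simp add: kernel_sqrt_def power_mult_distrib mult_ac)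
qed

text \<open>The kernel has coefficients (n + 1) times the powers of \<open>cnj z\<close>, and the
  n-th moment of |w|^2 is 1/(n + 1). The two factors cancel in Parseval's identity and leave the
  power series of \<open>g\<close> at \<open>z\<close>.\<close>

lemma reproducing:
  assumes ga: "has_coeffs g a" and B: "\<And>w. w \<in> disc \<Longrightarrow> cmod (g w) \<le> B" and z: "z \<in> disc"
  shows "(\<integral>w. g w * cnj (kernel_sqrt z w) \<partial>disc_area) = g z"
proof -
  interpret D: prob_space disc_area by (rule prob_space_disc_area)
  define m where "m n w = (((cmod w)\<^sup>2) ^ n)" for n w
  define c where "c n = 2 * pi * (a n * cnj (of_nat (n + 1) * cnj z ^ n))" for n
  have cz: "c n / of_nat (n + 1) = 2 * pi * (a n * z ^ n)" for n
  proof -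
    have "1 + complex_of_nat n \<noteq> 0"
      by (metis of_nat_Suc of_nat_neq_0)
    then show ?thesis
      by (simp add: c_def field_simps)
  qed
  have mm: "m n \<in> borel_measurable disc_area" for n
    unfolding m_def by (rule measurable_compose[OF measurable_disc_area_id]) measurable
  have m: "has_bochner_integral disc_area (m n) (1 / real (n + 1))" for n
  proof (rule has_bochner_integral_nn_integral)
    show "(\<integral>\<^sup>+w. ennreal (m n w) \<partial>disc_area) = ennreal (1 / real (n + 1))"
      using nn_integral_disc_area_moment[of n] by (simp add: m_def add_ac)
  qed (use mm in \<open>auto simp: m_def\<close>)
  have cm: "has_bochner_integral disc_area (\<lambda>w. c n * of_real (m n w)) (2 * pi * (a n * z ^ n))" for n
    using has_bochner_integral_mult_right[OF has_bochner_integral_of_real[OF m[of n]], of "c n"]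
      cz[of n] by (simp add: field_simps)
  have ncm: "(\<integral>w. cmod (c n * of_real (m n w)) \<partial>disc_area) = 2 * pi * cmod (a n * z ^ n)" for n
  proof -
    have "cmod (c n * of_real (m n w)) = cmod (c n) * m n w" for w
      by (simp add: norm_mult norm_power m_def)
    then have "(\<integral>w. cmod (c n * of_real (m n w)) \<partial>disc_area) = cmod (c n) * (1 / real (n + 1))"
      using has_bochner_integral_integral_eq[OF has_bochner_integral_mult_right[OF m[of n], of "cmod (c n)"]]
      by simp
    also have "\<dots> = cmod (c n / of_nat (n + 1))"
      by (simp add: norm_divide del: of_nat_Suc)
    also have "\<dots> = 2 * pi * cmod (a n * z ^ n)"
      using cz[of n] by (simp add: norm_mult)
    finally show ?thesis .
  qed
  \<comment> \<open>Termwise integration needs pointwise absolute summability: the terms of the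
    series of \<open>g\<close> are bounded, and those of the kernel series are absolutely
    summable.\<close>
  have sm: "summable (\<lambda>n. cmod (c n * of_real (m n w)))" if w: "w \<in> disc" for w
  proof -
    define A where "A = (\<Sum>n. cmod (a n * w ^ n))"
    define b where "b n = of_nat (n + 1) * cnj z ^ n" for n
    have sa: "summable (\<lambda>n. cmod (a n * w ^ n))"
      by (rule has_coeffs_abs_summable[OF ga w])
    have sb: "summable (\<lambda>n. cmod (b n * w ^ n))"
      unfolding b_def by (rule has_coeffs_abs_summable[OF kernel_sqrt_coeffs[OF z] w])
    have A: "cmod (a n * w ^ n) \<le> A" for n
      unfolding A_def using sum_le_suminf[OF sa, of "{n}"] by simp
    show ?thesis
    proof (rule summable_comparison_test')
      show "summable (\<lambda>n. 2 * pi * (A * cmod (b n * w ^ n)))"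
        by (intro summable_mult sb)
      show "norm (cmod (c n * of_real (m n w))) \<le> 2 * pi * (A * cmod (b n * w ^ n))" for n
      proof -
        have "norm (cmod (c n * of_real (m n w))) = 2 * pi * (cmod (a n * w ^ n) * cmod (b n * w ^ n))"
          by (simp add: c_def b_def m_def norm_mult norm_power power_mult_distrib power2_eq_square)
        also have "\<dots> \<le> 2 * pi * (A * cmod (b n * w ^ n))"
          by (intro mult_left_mono mult_right_mono A) auto
        finally show ?thesis .
      qed
    qed
  qed
  have avg: "(\<integral>\<zeta>. g (\<zeta> * w) * cnj (kernel_sqrt z (\<zeta> * w)) \<partial>circle_arc_length) = (\<Sum>n. c n * of_real (m n w))"
    if w: "w \<in> disc" for w
  proof -
    have "(\<lambda>n. 2 * pi * (a n * cnj (of_nat (n + 1) * cnj z ^ n) * ((cmod w)\<^sup>2) ^ n)) =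
        (\<lambda>n. c n * of_real (m n w))"
      by (simp add: c_def m_def fun_eq_iff)
    with circle_parseval[OF ga kernel_sqrt_coeffs[OF z] w] show ?thesis
      by (simp only: sums_iff)
  qed
  have "2 * pi * (\<integral>w. g w * cnj (kernel_sqrt z w) \<partial>disc_area) =
      (\<integral>w. (\<integral>\<zeta>. g (\<zeta> * w) * cnj (kernel_sqrt z (\<zeta> * w)) \<partial>circle_arc_length) \<partial>disc_area)"
  proof (rule integral_disc_area_average[symmetric, where B = "B * (1 / (1 - cmod z)\<^sup>2)"])
    show "continuous_on disc (\<lambda>w. g w * cnj (kernel_sqrt z w))"
      using holomorphic_on_imp_continuous_on[OF has_coeffs_holomorphic[OF ga]]
        holomorphic_on_imp_continuous_on[OF holomorphic_kernel_sqrt[OF z]]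
      by (intro continuous_intros)
    show "cmod (g w * cnj (kernel_sqrt z w)) \<le> B * (1 / (1 - cmod z)\<^sup>2)" if "w \<in> disc" for w
      unfolding norm_mult complex_mod_cnj
      using B[OF that] norm_kernel_sqrt_le[OF z that] by (intro mult_mono') auto
  qed
  also have "\<dots> = (\<integral>w. (\<Sum>n. c n * of_real (m n w)) \<partial>disc_area)"
    by (intro Bochner_Integration.integral_cong refl avg) simp
  also have "\<dots> = (\<Sum>n. \<integral>w. c n * of_real (m n w) \<partial>disc_area)"
  proof (rule integral_suminf)
    show "integrable disc_area (\<lambda>w. c n * of_real (m n w))" for n
      using cm[of n] by (auto simp: has_bochner_integral_iff)
    show "AE w in disc_area. summable (\<lambda>n. cmod (c n * of_real (m n w)))"
      by (intro AE_I2 sm) simp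
    show "summable (\<lambda>n. \<integral>w. cmod (c n * of_real (m n w)) \<partial>disc_area)"
      unfolding ncm by (intro summable_mult has_coeffs_abs_summable[OF ga z])
  qed
  also have "\<dots> = (\<Sum>n. 2 * pi * (a n * z ^ n))"
    using cm by (simp add: has_bochner_integral_iff)
  also have "\<dots> = 2 * pi * g z"
    using ga z by (auto simp: has_coeffs_def intro!: sums_unique[symmetric] sums_mult)
  finally show ?thesis by simp
qed

subsection \<open>Mean square oscillation\<close>

definition berezin_density :: "complex \<Rightarrow> complex \<Rightarrow> real" where
  "berezin_density z w = (cmod (bergman_kernel z w))\<^sup>2"

lemma berezin_density_eq:
  "berezin_density z w = (1 - (cmod z)\<^sup>2)\<^sup>2 * (cmod (kernel_sqrt z w))\<^sup>2"
proof -
  have "bergman_kernel z w = of_real (1 - (cmod z)\<^sup>2) * kernel_sqrt z w"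
    by (simp add: bergman_kernel_def kernel_sqrt_def)
  then show ?thesis
    by (simp only: berezin_density_def norm_mult norm_of_real power_mult_distrib power2_abs)
qed

lemma berezin_density_nonneg [simp]: "0 \<le> berezin_density z w"
  by (simp add: berezin_density_def)

lemma berezin_density_rotate:
  assumes "cmod \<zeta> = 1"
  shows "berezin_density (\<zeta> * z) (\<zeta> * w) = berezin_density z w"
proof -
  have "cnj (\<zeta> * z) * (\<zeta> * w) = (cnj \<zeta> * \<zeta>) * (cnj z * w)" by simp
  also have "cnj \<zeta> * \<zeta> = 1"
    using complex_norm_square[of \<zeta>] assms by (simp add: mult.commute)
  finally have "cnj (\<zeta> * z) * (\<zeta> * w) = cnj z * w" by simp
  then show ?thesis
    using assms by (simp only: berezin_density_def bergman_kernel_def norm_mult) simp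
qed

lemma continuous_on_berezin_density: "z \<in> disc \<Longrightarrow> continuous_on disc (berezin_density z)"
  unfolding berezin_density_eq[abs_def]
  by (intro continuous_intros holomorphic_on_imp_continuous_on holomorphic_kernel_sqrt)

lemma berezin_density_le:
  assumes "z \<in> disc" "w \<in> disc"
  shows "berezin_density z w \<le> (1 / (1 - cmod z)\<^sup>2)\<^sup>2"
proof -
  have "(1 - (cmod z)\<^sup>2)\<^sup>2 * (cmod (kernel_sqrt z w))\<^sup>2 \<le> 1\<^sup>2 * (1 / (1 - cmod z)\<^sup>2)\<^sup>2"
    using norm_kernel_sqrt_le[OF assms] assms
    by (intro mult_mono power_mono) (auto simp: power_le_one)
  then show ?thesis by (simp add: berezin_density_eq)
qed

lemma measurable_berezin_density [measurable (raw)]: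
  assumes [measurable]: "f \<in> borel_measurable M" "g \<in> borel_measurable M"
  shows "(\<lambda>x. berezin_density (f x) (g x)) \<in> borel_measurable M"
proof -
  have [measurable]: "cnj \<in> borel_measurable borel"
    by (intro borel_measurable_continuous_onI continuous_intros)
  show ?thesis
    unfolding berezin_density_def bergman_kernel_def by measurable
qed

section \<open>Bounded analytic functions and the Berezin density\<close>

lemma H_infinityD:
  assumes "f \<in> H_infinity"
  shows "f holomorphic_on disc" "continuous_on disc f"
    "f \<in> borel_measurable (restrict_space borel disc)"
    "\<exists>B\<ge>0. \<forall>w\<in>disc. cmod (f w) \<le> B"
proof -
  show h: "f holomorphic_on disc" using assms by (simp add: H_infinity_def)
  show c: "continuous_on disc f" by (rule holomorphic_on_imp_continuous_on[OF h])
  show "f \<in> borel_measurable (restrict_space borel disc)"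
    by (rule borel_measurable_continuous_on_restrict[OF c])
  obtain B where B: "\<forall>w\<in>disc. cmod (f w) \<le> B"
    using assms unfolding H_infinity_def bounded_iff by auto
  then have "0 \<le> B" using order_trans[OF norm_ge_zero, of "f 0"] by auto
  with B show "\<exists>B\<ge>0. \<forall>w\<in>disc. cmod (f w) \<le> B" by blast
qed

lemma const_H_infinity: "(\<lambda>_. c) \<in> H_infinity"
  by (auto simp: H_infinity_def bounded_iff)

lemma integrable_berezin_density:
  fixes F :: "complex \<Rightarrow> 'a :: {banach, second_countable_topology}"
  assumes F: "continuous_on disc F" and B: "\<And>w. w \<in> disc \<Longrightarrow> norm (F w) \<le> B" and z: "z \<in> disc"
  shows "integrable disc_area (\<lambda>w. berezin_density z w *\<^sub>R F w)"
proof -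
  interpret prob_space disc_area by (rule prob_space_disc_area)
  show ?thesis
  proof (rule integrable_const_bound[where B = "(1 / (1 - cmod z)\<^sup>2)\<^sup>2 * B"])
    show "(\<lambda>w. berezin_density z w *\<^sub>R F w) \<in> borel_measurable disc_area"
      by (intro measurable_disc_areaI borel_measurable_continuous_on_restrict continuous_intros
          F continuous_on_berezin_density z)
    show "AE w in disc_area. norm (berezin_density z w *\<^sub>R F w) \<le> (1 / (1 - cmod z)\<^sup>2)\<^sup>2 * B"
      using berezin_density_le[OF z] B by (intro AE_I2) (auto intro!: mult_mono')
  qed
qed

text \<open>One factor of |\<open>kernel_sqrt z\<close>|^2 is analytic and can be merged into
  \<open>f\<close>. Reproducing the product at \<open>z\<close> gives
  \<open>f z * kernel_sqrt z z\<close>, and the normalization \<open>q\<close> is the reciprocal of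
  \<open>kernel_sqrt z z\<close>.\<close>

lemma berezin_H_infinity:
  assumes f: "f \<in> H_infinity" and z: "z \<in> disc"
  shows "(\<integral>w. berezin_density z w *\<^sub>R f w \<partial>disc_area) = f z"
proof -
  note f' = H_infinityD[OF f]
  obtain B where B: "\<And>w. w \<in> disc \<Longrightarrow> cmod (f w) \<le> B" "0 \<le> B" using f'(4) by blast
  define q where "q = (1 - (cmod z)\<^sup>2)\<^sup>2"
  have "(cmod z)\<^sup>2 < 1" using z by (simp add: abs_square_less_1)
  then have q: "q \<noteq> 0" by (simp add: q_def)
  have "(\<lambda>w. f w * kernel_sqrt z w) holomorphic_on disc"
    by (intro holomorphic_intros f' holomorphic_kernel_sqrt z)
  then obtain a where a: "has_coeffs (\<lambda>w. f w * kernel_sqrt z w) a"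
    using holomorphic_has_coeffs by blast
  have bd: "cmod (f w * kernel_sqrt z w) \<le> B * (1 / (1 - cmod z)\<^sup>2)" if "w \<in> disc" for w
    unfolding norm_mult using B norm_kernel_sqrt_le[OF z that] that by (intro mult_mono') auto
  have "(\<integral>w. berezin_density z w *\<^sub>R f w \<partial>disc_area) =
      (\<integral>w. of_real q * (f w * kernel_sqrt z w * cnj (kernel_sqrt z w)) \<partial>disc_area)"
    by (intro Bochner_Integration.integral_cong refl)
      (simp only: berezin_density_eq scaleR_conv_of_real flip: q_def, simp only: of_real_mult complex_norm_square mult_ac)
  also have "\<dots> = q * (f z * kernel_sqrt z z)"
  proof -
    have "(\<integral>w. f w * kernel_sqrt z w * cnj (kernel_sqrt z w) \<partial>disc_area) = f z * kernel_sqrt z z"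
      using reproducing[OF a bd z] .
    then show ?thesis by (simp only: integral_mult_right_zero)
  qed
  also have "kernel_sqrt z z = 1 / q"
    using complex_norm_square[of z] by (simp add: kernel_sqrt_def q_def mult.commute)
  finally show ?thesis using q by simp
qed

lemma integral_berezin_density:
  assumes z: "z \<in> disc"
  shows "integrable disc_area (berezin_density z)" "(\<integral>w. berezin_density z w \<partial>disc_area) = 1"
proof -
  show i: "integrable disc_area (berezin_density z)"
    using integrable_berezin_density[OF _ _ z, of "\<lambda>_. 1::real" 1] by simp
  have "complex_of_real (\<integral>w. berezin_density z w \<partial>disc_area) = 1"
    using berezin_H_infinity[OF const_H_infinity[of 1] z] by (simp add: scaleR_conv_of_real)
  then show "(\<integral>w. berezin_density z w \<partial>disc_area) = 1" by (simp only: of_real_eq_1_iff)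
qed

definition mean_square_osc :: "(complex \<Rightarrow> complex) \<Rightarrow> complex \<Rightarrow> ennreal" where
  "mean_square_osc f z = (\<integral>\<^sup>+w. ennreal ((cmod (f w - f z))\<^sup>2 * berezin_density z w) \<partial>disc_area)"

text \<open>Variance about the mean plus squared bias: \<open>f z\<close> is the mean of
  \<open>f\<close> for the density, so the cross term integrates to 0. The choice c = 0 feeds the
  coefficient computation, and c = \<open>f z'\<close> the comparison of nearby points.\<close>

lemma mean_square_osc_variance:
  assumes f: "f \<in> H_infinity" and z: "z \<in> disc"
  shows "(\<integral>\<^sup>+w. ennreal ((cmod (f w - c))\<^sup>2 * berezin_density z w) \<partial>disc_area) =
           mean_square_osc f z + ennreal ((cmod (f z - c))\<^sup>2)"
proof -
  note f' = H_infinityD[OF f]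
  obtain B where B: "\<And>w. w \<in> disc \<Longrightarrow> cmod (f w) \<le> B" "0 \<le> B" using f'(4) by blast
  have bd: "cmod (f w - c) \<le> B + cmod c" if "w \<in> disc" for w c
    using norm_triangle_ineq4[of "f w" c] B(1)[OF that] by linarith
  define q where "q c w = berezin_density z w *\<^sub>R ((cmod (f w - c))\<^sup>2)" for c w
  have iq: "integrable disc_area (q c)" for c
    unfolding q_def
    by (rule integrable_berezin_density[OF _ _ z, of _ "(B + cmod c)\<^sup>2"])
      (use f' bd in \<open>auto intro!: continuous_intros power_mono\<close>)
  have qq: "(\<integral>\<^sup>+w. ennreal ((cmod (f w - c))\<^sup>2 * berezin_density z w) \<partial>disc_area) =
      ennreal (\<integral>w. q c w \<partial>disc_area)" for c
  proof -
    have "(\<integral>\<^sup>+w. ennreal (q c w) \<partial>disc_area) = ennreal (\<integral>w. q c w \<partial>disc_area)"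
      by (rule nn_integral_eq_integral[OF iq]) (simp add: q_def)
    then show ?thesis by (simp add: q_def mult.commute)
  qed
  define d where "d = f z - c"
  have il: "integrable disc_area (\<lambda>w. berezin_density z w *\<^sub>R (f w - f z))"
    by (rule integrable_berezin_density[OF _ bd z]) (use f' in \<open>auto intro!: continuous_intros\<close>)
  have if0: "integrable disc_area (\<lambda>w. berezin_density z w *\<^sub>R f w)"
    by (rule integrable_berezin_density[OF _ B(1) z]) (use f' in auto)
  have "(\<integral>w. berezin_density z w *\<^sub>R (f w - f z) \<partial>disc_area) =
      (\<integral>w. berezin_density z w *\<^sub>R f w - berezin_density z w *\<^sub>R f z \<partial>disc_area)"
    by (simp add: scaleR_diff_right)
  also have "\<dots> = 0"
    using if0 integral_berezin_density[OF z] berezin_H_infinity[OF f z] by simp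
  finally have l0: "(\<integral>w. berezin_density z w *\<^sub>R (f w - f z) \<partial>disc_area) = 0" .
  have ix: "integrable disc_area (\<lambda>w. cnj d * (berezin_density z w *\<^sub>R (f w - f z)))"
    using il by (rule integrable_mult_right)
  have il2: "integrable disc_area (\<lambda>w. 2 * Re (cnj d * (berezin_density z w *\<^sub>R (f w - f z))))"
    using integrable_Re[OF ix] by (rule integrable_mult_right)
  have l2: "(\<integral>w. 2 * Re (cnj d * (berezin_density z w *\<^sub>R (f w - f z))) \<partial>disc_area) = 0"
    by (simp only: integral_mult_right_zero integral_Re[OF ix] l0) simp
  have eq: "q c w = q (f z) w + (cmod d)\<^sup>2 * berezin_density z w +
      2 * Re (cnj d * (berezin_density z w *\<^sub>R (f w - f z)))" for w
  proof -
    have "f w - c = (f w - f z) + d" by (simp add: d_def)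
    then have "(cmod (f w - c))\<^sup>2 = (cmod (f w - f z))\<^sup>2 + (cmod d)\<^sup>2 + 2 * Re (cnj d * (f w - f z))"
      by (simp only: cmod_power2) (simp add: power2_eq_square algebra_simps)
    moreover have "Re (cnj d * (berezin_density z w *\<^sub>R (f w - f z))) = berezin_density z w * Re (cnj d * (f w - f z))"
      by (simp only: mult_scaleR_right scaleR_complex.simps)
    ultimately show ?thesis
      by (simp only: q_def real_scaleR_def distrib_left mult_ac)
  qed
  have sum: "integral\<^sup>L disc_area (q c) = integral\<^sup>L disc_area (q (f z)) + (cmod d)\<^sup>2"
    unfolding eq using iq il2 l2 integral_berezin_density[OF z] by simp
  have "0 \<le> integral\<^sup>L disc_area (q (f z))"
    by (rule Bochner_Integration.integral_nonneg) (simp add: q_def)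
  then show ?thesis
    unfolding mean_square_osc_def qq d_def[symmetric] sum by (rule ennreal_plus) simp
qed

lemma measurable_disc_fst_snd [measurable]:
  "fst \<in> borel_measurable (disc_area \<Otimes>\<^sub>M M)" "snd \<in> borel_measurable (M \<Otimes>\<^sub>M disc_area)"
  "fst \<in> borel_measurable (restrict_space borel disc \<Otimes>\<^sub>M M)"
  "fst \<in> borel_measurable (circle_arc_length \<Otimes>\<^sub>M M)" "snd \<in> borel_measurable (M \<Otimes>\<^sub>M circle_arc_length)"
  by (rule measurable_compose[OF measurable_fst] measurable_compose[OF measurable_snd],
      rule measurable_disc_area_id measurable_circle_id measurable_restrict_space1[OF measurable_ident, unfolded id_def])+

lemma measurable_mean_square_osc:
  assumes f: "f \<in> H_infinity"
  shows "mean_square_osc f \<in> borel_measurable (restrict_space borel disc)"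
proof -
  interpret prob_space disc_area by (rule prob_space_disc_area)
  note fm = H_infinityD(3)[OF f]
  have [measurable]: "(\<lambda>p. f (fst p)) \<in> borel_measurable (restrict_space borel disc \<Otimes>\<^sub>M disc_area)"
    "(\<lambda>p. f (snd p)) \<in> borel_measurable (restrict_space borel disc \<Otimes>\<^sub>M disc_area)"
    using measurable_compose[OF measurable_fst fm]
      measurable_compose[OF measurable_snd measurable_disc_areaI[OF fm]] by auto
  show ?thesis
    unfolding mean_square_osc_def by (rule borel_measurable_nn_integral) (unfold case_prod_beta, measurable)
qed

lemma ennreal_mult_left_imp_eq: "ennreal c * a = ennreal c * b \<Longrightarrow> 0 < c \<Longrightarrow> a = b"
  by (auto simp: ennreal_mult_cancel_left)

text \<open>Averaging over rotations of \<open>w\<close> turns the density into the diagonal series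
  of squared kernel coefficients (k + 1)^2; the radial moment of order n + k then supplies the
  denominator.\<close>

lemma kernel_moment:
  assumes z: "z \<in> disc"
  shows "(\<integral>\<^sup>+w. ennreal (((cmod w)\<^sup>2) ^ n * berezin_density z w) \<partial>disc_area) =
    (\<Sum>k. ennreal ((1 - (cmod z)\<^sup>2)\<^sup>2 * ((real (k + 1))\<^sup>2 / real (n + k + 1) * ((cmod z)\<^sup>2) ^ k)))"
    (is "?L = (\<Sum>k. ennreal (?b k))")
proof -
  define x where "x = (cmod z)\<^sup>2"
  define q where "q = (1 - x)\<^sup>2"
  have x: "0 \<le> x" "0 \<le> q" by (auto simp: x_def q_def)
  have [measurable]: "(\<lambda>w. w) \<in> borel_measurable disc_area" by (rule measurable_disc_area_id)
  have [measurable]: "(\<lambda>w. w) \<in> borel_measurable (restrict_space borel disc)"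
    by (simp add: measurable_restrict_space1)
  have "ennreal (2 * pi) * ?L =
      (\<integral>\<^sup>+w. \<integral>\<^sup>+\<zeta>. ennreal (((cmod (\<zeta> * w))\<^sup>2) ^ n * berezin_density z (\<zeta> * w)) \<partial>circle_arc_length \<partial>disc_area)"
    by (rule nn_integral_disc_area_average[symmetric]) measurable
  also have "\<dots> = (\<integral>\<^sup>+w. (\<Sum>k. ennreal (2 * pi * (q * ((real (k + 1))\<^sup>2 * x ^ k))) * ennreal (((cmod w)\<^sup>2) ^ (n + k))) \<partial>disc_area)"
  proof (intro nn_integral_cong)
    fix w assume "w \<in> space disc_area"
    then have w: "w \<in> disc" by simp
    have ks: "(\<lambda>\<zeta>. ennreal ((cmod (kernel_sqrt z (\<zeta> * w)))\<^sup>2)) \<in> borel_measurable circle_arc_length"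
    proof -
      have "kernel_sqrt z \<in> borel_measurable (restrict_space borel disc)"
        by (intro borel_measurable_continuous_on_restrict holomorphic_on_imp_continuous_on holomorphic_kernel_sqrt z)
      moreover have "(\<lambda>\<zeta>. \<zeta> * w) \<in> circle_arc_length \<rightarrow>\<^sub>M restrict_space borel disc"
        using measurable_compose_Pair1[OF _ measurable_disc_times_circle, of w] w by simp
      ultimately have [measurable]: "(\<lambda>\<zeta>. kernel_sqrt z (\<zeta> * w)) \<in> borel_measurable circle_arc_length"
        by (rule measurable_compose[rotated])
      show ?thesis by measurable
    qed
    have "(\<integral>\<^sup>+\<zeta>. ennreal (((cmod (\<zeta> * w))\<^sup>2) ^ n * berezin_density z (\<zeta> * w)) \<partial>circle_arc_length) =
       (\<integral>\<^sup>+\<zeta>. ennreal (q * ((cmod w)\<^sup>2) ^ n) * ennreal ((cmod (kernel_sqrt z (\<zeta> * w)))\<^sup>2) \<partial>circle_arc_length)"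
      by (intro nn_integral_cong)
        (simp add: berezin_density_eq norm_mult q_def x_def mult_ac flip: ennreal_mult)
    also have "\<dots> = ennreal (q * ((cmod w)\<^sup>2) ^ n) *
        (\<Sum>k. ennreal (2 * pi * ((cmod (of_nat (k + 1) * cnj z ^ k))\<^sup>2 * ((cmod w)\<^sup>2) ^ k)))"
      using circle_parseval_norm[OF kernel_sqrt_coeffs[OF z] w] by (simp add: nn_integral_cmult[OF ks])
    also have "\<dots> = (\<Sum>k. ennreal (2 * pi * (q * ((real (k + 1))\<^sup>2 * x ^ k))) * ennreal (((cmod w)\<^sup>2) ^ (n + k)))"
    proof -
      have "ennreal (q * ((cmod w)\<^sup>2) ^ n) * ennreal (2 * pi * ((cmod (of_nat (k + 1) * cnj z ^ k))\<^sup>2 * ((cmod w)\<^sup>2) ^ k)) =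
         ennreal (2 * pi * (q * ((real (k + 1))\<^sup>2 * x ^ k))) * ennreal (((cmod w)\<^sup>2) ^ (n + k))" for k
      proof -
        have "(cmod (of_nat (k + 1) * cnj z ^ k))\<^sup>2 = (real (k + 1))\<^sup>2 * x ^ k"
          unfolding norm_mult norm_of_nat norm_power complex_mod_cnj x_def power_mult_distrib
          by (simp add: power_mult[symmetric] mult.commute)
        then show ?thesis
          using x by (simp add: power_add mult_ac flip: ennreal_mult)
      qed
      then show ?thesis by (simp only: ennreal_suminf_cmult[symmetric])
    qed
    finally show "(\<integral>\<^sup>+\<zeta>. ennreal (((cmod (\<zeta> * w))\<^sup>2) ^ n * berezin_density z (\<zeta> * w)) \<partial>circle_arc_length) =
       (\<Sum>k. ennreal (2 * pi * (q * ((real (k + 1))\<^sup>2 * x ^ k))) * ennreal (((cmod w)\<^sup>2) ^ (n + k)))" .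
  qed
  also have "\<dots> = (\<Sum>k. ennreal (2 * pi * (q * ((real (k + 1))\<^sup>2 * x ^ k))) * ennreal (1 / real (n + k + 1)))"
  proof (subst nn_integral_suminf)
    show "(\<Sum>k. \<integral>\<^sup>+w. ennreal (2 * pi * (q * ((real (k + 1))\<^sup>2 * x ^ k))) * ennreal (((cmod w)\<^sup>2) ^ (n + k)) \<partial>disc_area) =
      (\<Sum>k. ennreal (2 * pi * (q * ((real (k + 1))\<^sup>2 * x ^ k))) * ennreal (1 / real (n + k + 1)))"
      using nn_integral_disc_area_moment[of "n + k" for k]
      by (subst nn_integral_cmult) (measurable, simp add: add_ac)
  qed measurable
  also have "\<dots> = (\<Sum>k. ennreal (2 * pi) * ennreal (?b k))"
  proof (intro suminf_cong)
    fix k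
    have "2 * pi * (q * ((real (k + 1))\<^sup>2 * x ^ k)) * (1 / real (n + k + 1)) =
        2 * pi * (q * ((real (k + 1))\<^sup>2 / real (n + k + 1) * x ^ k))"
      by simp
    moreover have "0 \<le> 2 * pi * (q * ((real (k + 1))\<^sup>2 * x ^ k))"
      "0 \<le> q * ((real (k + 1))\<^sup>2 / real (n + k + 1) * x ^ k)"
      using x by simp_all
    ultimately show "ennreal (2 * pi * (q * ((real (k + 1))\<^sup>2 * x ^ k))) * ennreal (1 / real (n + k + 1)) =
        ennreal (2 * pi) * ennreal (?b k)"
      unfolding x_def[symmetric] q_def[symmetric]
      by (subst (1 2) ennreal_mult[symmetric]) simp_all
  qed
  also have "\<dots> = ennreal (2 * pi) * (\<Sum>k. ennreal (?b k))"
    by (rule ennreal_suminf_cmult)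
  finally show ?thesis
    by (rule ennreal_mult_left_imp_eq) simp
qed

subsection \<open>Circular averages of the oscillation\<close>

text \<open>\<open>(1 - x)\<^sup>2 * (\<Sum>k. osc_coeff n k * x ^ k)\<close> at \<open>x = |z|\<^sup>2\<close> is the difference of the Berezin transform of
  \<open>|w|\<^sup>2\<^sup>n\<close> at \<open>z\<close> and \<open>|z|\<^sup>2\<^sup>n\<close>. What matters is that these coefficients are nonnegative.\<close>

definition osc_coeff :: "nat \<Rightarrow> nat \<Rightarrow> real" where
  "osc_coeff n k = (if k < n then (real (k + 1))\<^sup>2 else (real n)\<^sup>2) / real (n + k + 1)"

lemma osc_coeff_nonneg: "0 \<le> osc_coeff n k"
  by (simp add: osc_coeff_def)

text \<open>For k \<ge> n this is division with remainder, (k + 1)^2 - n^2 = (k + 1 - n)(k + 1 + n).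
  The quotients k + 1 - n are the coefficients of x^n/(1 - x)^2, so splitting them off subtracts x^n
  from the moment and leaves nonnegative coefficients.\<close>

lemma osc_coeff_add:
  "(real (k + 1))\<^sup>2 / real (n + k + 1) = osc_coeff n k + (if k < n then 0 else real (k + 1 - n))"
proof (cases "k < n")
  case False
  then obtain j where "k = n + j" using le_Suc_ex not_le by blast
  moreover have "n + j + 1 - n = j + 1" by simp
  moreover have "real (n + (n + j) + 1) \<noteq> 0" by (simp only: of_nat_eq_0_iff)
  ultimately show ?thesis
    by (simp add: osc_coeff_def field_simps power2_eq_square)
qed (simp add: osc_coeff_def)

lemma suminf_power_shifted:
  assumes x: "0 \<le> x" "x < 1"
  shows "(\<Sum>k. ennreal ((1 - x)\<^sup>2 * ((if k < n then 0 else real (k + 1 - n)) * x ^ k))) = ennreal (x ^ n)"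
proof (rule suminf_ennreal_eq)
  show "0 \<le> (1 - x)\<^sup>2 * ((if k < n then 0 else real (k + 1 - n)) * x ^ k)" for k
    using x by simp
  have "(\<lambda>j. (1 - x)\<^sup>2 * x ^ n * (of_nat (Suc j) * x ^ j)) sums ((1 - x)\<^sup>2 * x ^ n * (1 / (1 - x)\<^sup>2))"
    using x by (intro sums_mult geometric_deriv_sums) auto
  then have "(\<lambda>j. (1 - x)\<^sup>2 * ((if j + n < n then 0 else real (j + n + 1 - n)) * x ^ (j + n))) sums (x ^ n)"
    using x by (simp add: power_add mult_ac del: of_nat_Suc)
  then show "(\<lambda>k. (1 - x)\<^sup>2 * ((if k < n then 0 else real (k + 1 - n)) * x ^ k)) sums (x ^ n)"
    by (subst sums_zero_iff_shift[symmetric, of n]) auto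
qed

lemma kernel_moment_osc:
  assumes z: "z \<in> disc"
  shows "(\<integral>\<^sup>+w. ennreal (((cmod w)\<^sup>2) ^ n * berezin_density z w) \<partial>disc_area) =
    (\<Sum>k. ennreal ((1 - (cmod z)\<^sup>2)\<^sup>2 * (osc_coeff n k * ((cmod z)\<^sup>2) ^ k))) + ennreal (((cmod z)\<^sup>2) ^ n)"
proof -
  define x where "x = (cmod z)\<^sup>2"
  have x: "0 \<le> x" "x < 1" using z by (auto simp: x_def abs_square_less_1)
  have "ennreal ((1 - x)\<^sup>2 * ((real (k + 1))\<^sup>2 / real (n + k + 1) * x ^ k)) =
      ennreal ((1 - x)\<^sup>2 * (osc_coeff n k * x ^ k)) +
      ennreal ((1 - x)\<^sup>2 * ((if k < n then 0 else real (k + 1 - n)) * x ^ k))" for k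
    unfolding osc_coeff_add using x osc_coeff_nonneg[of n k]
    by (subst ennreal_plus[symmetric]) (auto simp: algebra_simps)
  then show ?thesis
    unfolding kernel_moment[OF z] x_def[symmetric] suminf_power_shifted[OF x, of n, symmetric]
    by (simp only: suminf_add[OF summableI summableI, symmetric])
qed

text \<open>The point is uniformity in \<open>n\<close>: the weighted integral is then controlled by
  the sum of |a_n|^2 alone. The denominators are the moments of (1 - |z|^2)|z|^2k.\<close>

lemma osc_coeff_suminf_le:
  "(\<Sum>k. ennreal (osc_coeff n k / (real (k + 1) * real (k + 2)))) \<le> 2"
proof (rule suminf_le_const[OF summableI])
  fix N
  \<comment> \<open>Terms with k < n are at most 1/n each. From k = n on,
    \<open>osc_coeff n k\<close> is at most \<open>n\<close>, and n/((k + 1)(k + 2)) telescopes. The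
    two bounds are compatible at N = n because n/(n + 1) \<le> 1.\<close>
  have *: "(\<Sum>k<N. osc_coeff n k / (real (k + 1) * real (k + 2))) \<le>
      (if N \<le> n then real N / real n else 2 - real n / real (N + 1))"
  proof (induction N)
    case (Suc N)
    have N0: "real (N + 1) > 0" "real (N + 2) > 0" by simp_all
    show ?case
    proof (cases "N < n")
      case True
      have "osc_coeff n N / (real (N + 1) * real (N + 2)) =
          (real (N + 1) / real (N + 2)) * (1 / real (n + N + 1))"
        using True by (simp add: osc_coeff_def power2_eq_square)
      also have "\<dots> \<le> 1 * (1 / real n)"
        using True by (intro mult_mono frac_le) auto
      finally have "osc_coeff n N / (real (N + 1) * real (N + 2)) \<le> 1 / real n" by simp
      with Suc True show ?thesis by (simp add: add_divide_distrib)
    next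
      case False
      have "osc_coeff n N \<le> real n"
      proof -
        have "(real n)\<^sup>2 \<le> real n * real (n + N + 1)"
          unfolding power2_eq_square by (intro mult_left_mono) auto
        then show ?thesis
          using False by (simp add: osc_coeff_def pos_divide_le_eq)
      qed
      then have "osc_coeff n N / (real (N + 1) * real (N + 2)) \<le> real n / (real (N + 1) * real (N + 2))"
        by (intro divide_right_mono) auto
      also have "\<dots> = real n / real (N + 1) - real n / real (N + 2)"
        by (simp add: divide_simps) (simp add: algebra_simps)
      finally have a: "osc_coeff n N / (real (N + 1) * real (N + 2)) \<le> real n / real (N + 1) - real n / real (N + 2)" .
      have "(\<Sum>k<N. osc_coeff n k / (real (k + 1) * real (k + 2))) \<le> 2 - real n / real (N + 1)"
      proof (cases "N \<le> n")
        case True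
        with False have "N = n" by simp
        \<comment> \<open>For n = 0 the first quotient is 0 by the convention on division.\<close>
        moreover have "real n / real n \<le> 1" "real n / real (n + 1) \<le> 1" by (auto simp: divide_simps)
        ultimately show ?thesis using Suc by (simp only: le_refl if_True)
      qed (use Suc in simp)
      with a False show ?thesis by (simp add: add_ac)
    qed
  qed simp
  also have "\<dots> \<le> 2"
    by (auto simp: divide_simps)
  finally have "ennreal (\<Sum>k<N. osc_coeff n k / (real (k + 1) * real (k + 2))) \<le> ennreal 2"
    by (rule ennreal_leI)
  then show "(\<Sum>k<N. ennreal (osc_coeff n k / (real (k + 1) * real (k + 2)))) \<le> 2"
    by (subst sum_ennreal) (auto simp: osc_coeff_nonneg)
qed

text \<open>Parseval's identity on circles of radius r < 1 bounds every partial sum weighted by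
  r^2n. A finite sum is continuous in \<open>r\<close>, so r may tend to 1 without boundary values
  of \<open>f\<close>.\<close>

lemma coeffs_square_summable:
  assumes fa: "has_coeffs f a" and B: "\<And>w. w \<in> disc \<Longrightarrow> cmod (f w) \<le> B"
  shows "(\<Sum>n. ennreal ((cmod (a n))\<^sup>2)) \<le> ennreal (B\<^sup>2)"
proof (rule suminf_le_const[OF summableI])
  fix N
  have le: "(\<Sum>n<N. (cmod (a n))\<^sup>2 * (r\<^sup>2) ^ n) \<le> B\<^sup>2" if r: "0 < r" "r < 1" for r :: real
  proof -
    have w: "complex_of_real r \<in> disc" and r': "cmod (complex_of_real r) = r" using r by auto
    have "(\<Sum>n<N. ennreal (2 * pi * ((cmod (a n))\<^sup>2 * (r\<^sup>2) ^ n))) \<le>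
        (\<Sum>n. ennreal (2 * pi * ((cmod (a n))\<^sup>2 * (r\<^sup>2) ^ n)))"
      by (rule sum_le_suminf) auto
    also have "\<dots> = (\<integral>\<^sup>+\<zeta>. ennreal ((cmod (f (\<zeta> * r)))\<^sup>2) \<partial>circle_arc_length)"
      using circle_parseval_norm[OF fa w] unfolding r' by simp
    also have "\<dots> \<le> (\<integral>\<^sup>+\<zeta>. ennreal (B\<^sup>2) \<partial>circle_arc_length)"
      using r by (intro nn_integral_mono ennreal_leI power_mono B) (auto simp: norm_mult)
    also have "\<dots> = ennreal (2 * pi * B\<^sup>2)"
      by (simp add: emeasure_circle_space mult_ac flip: ennreal_mult)
    finally have "ennreal (\<Sum>n<N. 2 * pi * ((cmod (a n))\<^sup>2 * (r\<^sup>2) ^ n)) \<le> ennreal (2 * pi * B\<^sup>2)"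
      by (subst (asm) sum_ennreal) auto
    then have "2 * pi * (\<Sum>n<N. (cmod (a n))\<^sup>2 * (r\<^sup>2) ^ n) \<le> 2 * pi * B\<^sup>2"
      by (subst (asm) ennreal_le_iff) (auto simp: sum_distrib_left)
    then show ?thesis by simp
  qed
  have "((\<lambda>r. \<Sum>n<N. (cmod (a n))\<^sup>2 * (r\<^sup>2) ^ n) \<longlongrightarrow> (\<Sum>n<N. (cmod (a n))\<^sup>2 * (1\<^sup>2) ^ n)) (at_left (1::real))"
    by (intro tendsto_intros)
  moreover have "eventually (\<lambda>r. (\<Sum>n<N. (cmod (a n))\<^sup>2 * (r\<^sup>2) ^ n) \<le> B\<^sup>2) (at_left (1::real))"
    using eventually_at_left_real[of 0 "1::real"] by (auto elim!: eventually_mono intro!: le)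
  ultimately have "(\<Sum>n<N. (cmod (a n))\<^sup>2 * (1\<^sup>2) ^ n) \<le> B\<^sup>2"
    by (rule tendsto_upperbound) simp
  then show "(\<Sum>n<N. ennreal ((cmod (a n))\<^sup>2)) \<le> ennreal (B\<^sup>2)"
    by (subst sum_ennreal) (auto intro!: ennreal_leI)
qed

text \<open>Averaging "variance = second moment - squared mean" over the circle diagonalizes both
  terms on the right. Each |a_n|^2 is then multiplied by the n-th moment of the density minus
  |z|^2n, the difference expanded by \<open>osc_coeff\<close>.\<close>

lemma mean_square_osc_circle_average:
  assumes f: "f \<in> H_infinity" and fa: "has_coeffs f a" and z: "z \<in> disc"
  shows "(\<integral>\<^sup>+\<zeta>. mean_square_osc f (\<zeta> * z) \<partial>circle_arc_length) =
    (\<Sum>n. ennreal (2 * pi * (cmod (a n))\<^sup>2) *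
      (\<Sum>k. ennreal ((1 - (cmod z)\<^sup>2)\<^sup>2 * (osc_coeff n k * ((cmod z)\<^sup>2) ^ k))))"
    (is "?L = (\<Sum>n. ?a n * ?S n)")
proof -
  note f' = H_infinityD[OF f]
  obtain B where B: "\<And>w. w \<in> disc \<Longrightarrow> cmod (f w) \<le> B" using f'(4) by blast
  interpret D: prob_space disc_area by (rule prob_space_disc_area)
  interpret pair_sigma_finite disc_area circle_arc_length by (rule pair_sigma_finite_disc_circle)
  define x where "x = (cmod z)\<^sup>2"
  have x: "0 \<le> x" by (simp add: x_def)
  have rot: "(\<lambda>\<zeta>. \<zeta> * w) \<in> circle_arc_length \<rightarrow>\<^sub>M restrict_space borel disc" if "w \<in> disc" for w
    using measurable_compose_Pair1[OF _ measurable_disc_times_circle, of w] that by simp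
  have [measurable]: "(\<lambda>\<zeta>. f (\<zeta> * w)) \<in> borel_measurable circle_arc_length" if "w \<in> disc" for w
    using measurable_compose[OF rot[OF that] f'(3)] .
  have [measurable]: "(\<lambda>\<zeta>. mean_square_osc f (\<zeta> * z)) \<in> borel_measurable circle_arc_length"
    using measurable_compose[OF rot[OF z] measurable_mean_square_osc[OF f]] .
  have [measurable]: "f \<in> borel_measurable (restrict_space borel disc)" by fact
  have [measurable]: "(\<lambda>w. w) \<in> borel_measurable disc_area" by (rule measurable_disc_area_id)
  have [measurable]: "(\<lambda>w. w) \<in> borel_measurable (restrict_space borel disc)"
    by (simp add: measurable_restrict_space1)
  have [measurable]: "(\<lambda>p. f (snd p * fst p)) \<in> borel_measurable (disc_area \<Otimes>\<^sub>M circle_arc_length)"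
    using measurable_compose[OF measurable_disc_times_circle f'(3)] by (simp add: case_prod_beta)
  have p1: "(\<integral>\<^sup>+\<zeta>. ennreal ((cmod (f (\<zeta> * z)))\<^sup>2) \<partial>circle_arc_length) = (\<Sum>n. ?a n * ennreal (x ^ n))"
    unfolding circle_parseval_norm[OF fa z] x_def by (intro suminf_cong) (simp add: mult_ac flip: ennreal_mult)
  \<comment> \<open>The squared means are added on both sides and cancelled at the end; cancellation
    in \<open>ennreal\<close> requires their average to be finite.\<close>
  have "(\<integral>\<^sup>+\<zeta>. ennreal ((cmod (f (\<zeta> * z)))\<^sup>2) \<partial>circle_arc_length) \<le> (\<integral>\<^sup>+\<zeta>. ennreal (B\<^sup>2) \<partial>circle_arc_length)"
    using z by (intro nn_integral_mono ennreal_leI power_mono B) (auto simp: norm_mult)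
  also have "\<dots> < \<infinity>"
    by (simp add: emeasure_circle_space flip: ennreal_mult)
  finally have fin: "(\<Sum>n. ?a n * ennreal (x ^ n)) \<noteq> \<infinity>" unfolding p1 by simp
  \<comment> \<open>Rotating \<open>w\<close> together with \<open>z\<close> frees the density of
    \<zeta>, so after exchanging the integrals only \<open>f (\<zeta> * w)\<close> remains to be
    averaged.\<close>
  have var: "mean_square_osc f (\<zeta> * z) + ennreal ((cmod (f (\<zeta> * z)))\<^sup>2) =
      (\<integral>\<^sup>+w. ennreal ((cmod (f (\<zeta> * w)))\<^sup>2 * berezin_density z w) \<partial>disc_area)"
    if \<zeta>: "\<zeta> \<in> space circle_arc_length" for \<zeta>
  proof -
    have \<zeta>1: "cmod \<zeta> = 1" using \<zeta> by simp
    then have zz: "\<zeta> * z \<in> disc" using z by (simp add: norm_mult)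
    have "mean_square_osc f (\<zeta> * z) + ennreal ((cmod (f (\<zeta> * z)))\<^sup>2) =
        (\<integral>\<^sup>+w. ennreal ((cmod (f w))\<^sup>2 * berezin_density (\<zeta> * z) w) \<partial>disc_area)"
      using mean_square_osc_variance[OF f zz, of 0] by simp
    also have "\<dots> = (\<integral>\<^sup>+w. ennreal ((cmod (f (\<zeta> * w)))\<^sup>2 * berezin_density (\<zeta> * z) (\<zeta> * w)) \<partial>disc_area)"
      by (rule nn_integral_disc_area_rotate[symmetric, OF _ \<zeta>1]) measurable
    finally show ?thesis by (simp only: berezin_density_rotate[OF \<zeta>1])
  qed
  have "?L + (\<Sum>n. ?a n * ennreal (x ^ n)) =
      (\<integral>\<^sup>+\<zeta>. mean_square_osc f (\<zeta> * z) + ennreal ((cmod (f (\<zeta> * z)))\<^sup>2) \<partial>circle_arc_length)"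
    unfolding p1[symmetric] using z by (intro nn_integral_add[symmetric]) measurable
  also have "\<dots> = (\<integral>\<^sup>+\<zeta>. \<integral>\<^sup>+w. ennreal ((cmod (f (\<zeta> * w)))\<^sup>2 * berezin_density z w) \<partial>disc_area \<partial>circle_arc_length)"
    by (intro nn_integral_cong var)
  also have "\<dots> = (\<integral>\<^sup>+w. \<integral>\<^sup>+\<zeta>. ennreal ((cmod (f (\<zeta> * w)))\<^sup>2 * berezin_density z w) \<partial>circle_arc_length \<partial>disc_area)"
    by (rule Fubini') (unfold case_prod_beta, measurable)
  also have "\<dots> = (\<integral>\<^sup>+w. (\<Sum>n. ?a n * ennreal (((cmod w)\<^sup>2) ^ n * berezin_density z w)) \<partial>disc_area)"
  proof (intro nn_integral_cong)
    fix w assume "w \<in> space disc_area"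
    then have w: "w \<in> disc" by simp
    have "(\<integral>\<^sup>+\<zeta>. ennreal ((cmod (f (\<zeta> * w)))\<^sup>2 * berezin_density z w) \<partial>circle_arc_length) =
        (\<integral>\<^sup>+\<zeta>. ennreal ((cmod (f (\<zeta> * w)))\<^sup>2) \<partial>circle_arc_length) * ennreal (berezin_density z w)"
      using w by (subst nn_integral_multc[symmetric]) (auto simp: ennreal_mult)
    also have "\<dots> = (\<Sum>n. ennreal (2 * pi * ((cmod (a n))\<^sup>2 * ((cmod w)\<^sup>2) ^ n)) * ennreal (berezin_density z w))"
      unfolding circle_parseval_norm[OF fa w] by (rule ennreal_suminf_multc[symmetric])
    also have "\<dots> = (\<Sum>n. ?a n * ennreal (((cmod w)\<^sup>2) ^ n * berezin_density z w))"
      by (intro suminf_cong) (simp add: mult_ac flip: ennreal_mult)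
    finally show "(\<integral>\<^sup>+\<zeta>. ennreal ((cmod (f (\<zeta> * w)))\<^sup>2 * berezin_density z w) \<partial>circle_arc_length) =
        (\<Sum>n. ?a n * ennreal (((cmod w)\<^sup>2) ^ n * berezin_density z w))" .
  qed
  also have "\<dots> = (\<Sum>n. ?a n * (\<integral>\<^sup>+w. ennreal (((cmod w)\<^sup>2) ^ n * berezin_density z w) \<partial>disc_area))"
    by (subst nn_integral_suminf, measurable, subst nn_integral_cmult, measurable)
  also have "\<dots> = (\<Sum>n. ?a n * ?S n + ?a n * ennreal (x ^ n))"
    by (simp only: kernel_moment_osc[OF z] x_def ring_distribs)
  also have "\<dots> = (\<Sum>n. ?a n * ?S n) + (\<Sum>n. ?a n * ennreal (x ^ n))"
    by (rule suminf_add[OF summableI summableI, symmetric])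
  finally have "(\<Sum>n. ?a n * ennreal (x ^ n)) + ?L = (\<Sum>n. ?a n * ennreal (x ^ n)) + (\<Sum>n. ?a n * ?S n)"
    by (simp only: add.commute)
  then show ?thesis
    using fin by (simp only: ennreal_add_left_cancel) simp
qed

text \<open>The weight cancels one of the two factors 1 - |z|^2 in the circular average; the other
  produces the moments 1/((k + 1)(k + 2)). The inner sums are at most 2, and the sum of |a_n|^2 is
  at most B^2.\<close>

lemma mean_square_osc_weighted_finite:
  assumes f: "f \<in> H_infinity"
  shows "(\<integral>\<^sup>+z. mean_square_osc f z * ennreal (1 / (1 - (cmod z)\<^sup>2)) \<partial>disc_area) < \<infinity>"
    (is "?I < \<infinity>")
proof -
  note f' = H_infinityD[OF f]
  obtain B where B: "\<And>w. w \<in> disc \<Longrightarrow> cmod (f w) \<le> B" using f'(4) by blast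
  obtain a where fa: "has_coeffs f a" using holomorphic_has_coeffs[OF f'(1)] by blast
  have [measurable]: "(\<lambda>w. w) \<in> borel_measurable disc_area" by (rule measurable_disc_area_id)
  have [measurable]: "(\<lambda>w. w) \<in> borel_measurable (restrict_space borel disc)"
    by (simp add: measurable_restrict_space1)
  note [measurable] = measurable_mean_square_osc[OF f]
  let ?a = "\<lambda>n. ennreal (2 * pi * (cmod (a n))\<^sup>2)"
  have "ennreal (2 * pi) * ?I =
      (\<integral>\<^sup>+z. \<integral>\<^sup>+\<zeta>. mean_square_osc f (\<zeta> * z) * ennreal (1 / (1 - (cmod (\<zeta> * z))\<^sup>2)) \<partial>circle_arc_length \<partial>disc_area)"
    by (rule nn_integral_disc_area_average[symmetric]) measurable
  also have "\<dots> = (\<integral>\<^sup>+z. (\<Sum>n. ?a n * (\<Sum>k. ennreal (osc_coeff n k) * ennreal ((1 - (cmod z)\<^sup>2) * ((cmod z)\<^sup>2) ^ k))) \<partial>disc_area)"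
  proof (intro nn_integral_cong)
    fix z assume "z \<in> space disc_area"
    then have z: "z \<in> disc" by simp
    have z1: "(cmod z)\<^sup>2 < 1" using z by (simp add: abs_square_less_1)
    have [measurable]: "(\<lambda>\<zeta>. mean_square_osc f (\<zeta> * z)) \<in> borel_measurable circle_arc_length"
      using measurable_compose[OF measurable_compose_Pair1[OF _ measurable_disc_times_circle, of z]
          measurable_mean_square_osc[OF f]] z by simp
    have "(\<integral>\<^sup>+\<zeta>. mean_square_osc f (\<zeta> * z) * ennreal (1 / (1 - (cmod (\<zeta> * z))\<^sup>2)) \<partial>circle_arc_length) =
      (\<integral>\<^sup>+\<zeta>. mean_square_osc f (\<zeta> * z) * ennreal (1 / (1 - (cmod z)\<^sup>2)) \<partial>circle_arc_length)"
      by (intro nn_integral_cong) (simp add: norm_mult)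
    also have "\<dots> = (\<integral>\<^sup>+\<zeta>. mean_square_osc f (\<zeta> * z) \<partial>circle_arc_length) * ennreal (1 / (1 - (cmod z)\<^sup>2))"
      by (rule nn_integral_multc) measurable
    also have "\<dots> = (\<Sum>n. ?a n * (\<Sum>k. ennreal (osc_coeff n k) * ennreal ((1 - (cmod z)\<^sup>2) * ((cmod z)\<^sup>2) ^ k)))"
    proof -
      have "ennreal ((1 - (cmod z)\<^sup>2)\<^sup>2 * (osc_coeff n k * ((cmod z)\<^sup>2) ^ k)) * ennreal (1 / (1 - (cmod z)\<^sup>2)) =
          ennreal (osc_coeff n k) * ennreal ((1 - (cmod z)\<^sup>2) * ((cmod z)\<^sup>2) ^ k)" for n k
      proof -
        define y p where "y = 1 - (cmod z)\<^sup>2" and "p = ((cmod z)\<^sup>2) ^ k"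
        have "0 < y" "0 \<le> p" using z1 by (auto simp: y_def p_def)
        moreover have "y\<^sup>2 * (osc_coeff n k * p) * (1 / y) = osc_coeff n k * (y * p)"
          using \<open>0 < y\<close> by (simp add: power2_eq_square)
        ultimately show ?thesis
          unfolding y_def[symmetric] p_def[symmetric] using osc_coeff_nonneg[of n k]
          by (simp only: ennreal_mult[symmetric] mult_nonneg_nonneg zero_le_power2 less_imp_le zero_le_divide_1_iff)
      qed
      then show ?thesis
        unfolding mean_square_osc_circle_average[OF f fa z]
        by (simp only: ennreal_suminf_multc[symmetric] mult.assoc)
    qed
    finally show "(\<integral>\<^sup>+\<zeta>. mean_square_osc f (\<zeta> * z) * ennreal (1 / (1 - (cmod (\<zeta> * z))\<^sup>2)) \<partial>circle_arc_length) =
      (\<Sum>n. ?a n * (\<Sum>k. ennreal (osc_coeff n k) * ennreal ((1 - (cmod z)\<^sup>2) * ((cmod z)\<^sup>2) ^ k)))" .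
  qed
  also have "\<dots> = (\<Sum>n. ?a n * (\<Sum>k. ennreal (osc_coeff n k) *
       (\<integral>\<^sup>+z. ennreal ((1 - (cmod z)\<^sup>2) * ((cmod z)\<^sup>2) ^ k) \<partial>disc_area)))"
    by (subst nn_integral_suminf, measurable, subst nn_integral_cmult, measurable,
        subst nn_integral_suminf, measurable, subst nn_integral_cmult, measurable)
  also have "\<dots> = (\<Sum>n. ?a n * (\<Sum>k. ennreal (osc_coeff n k / (real (k + 1) * real (k + 2)))))"
    unfolding nn_integral_disc_area_moment2
    by (intro suminf_cong arg_cong2[of _ _ _ _ "(*)"] refl, subst ennreal_mult[symmetric]) (auto simp: osc_coeff_nonneg)
  also have "\<dots> \<le> (\<Sum>n. ?a n * 2)"
    by (intro suminf_le mult_left_mono osc_coeff_suminf_le summableI) auto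
  also have "\<dots> = (\<Sum>n. ennreal (4 * pi) * ennreal ((cmod (a n))\<^sup>2))"
    by (intro suminf_cong) (simp add: mult_ac flip: ennreal_mult ennreal_numeral)
  also have "\<dots> = ennreal (4 * pi) * (\<Sum>n. ennreal ((cmod (a n))\<^sup>2))"
    by (rule ennreal_suminf_cmult)
  also have "\<dots> \<le> ennreal (4 * pi) * ennreal (B\<^sup>2)"
    by (intro mult_left_mono coeffs_square_summable[OF fa B]) auto
  also have "\<dots> < \<infinity>"
    by (simp flip: ennreal_mult)
  finally show ?thesis
    by (auto simp: ennreal_mult_less_top)
qed

subsection \<open>Nontangential decay for bounded analytic functions\<close>

text \<open>The second factor is the density of Moebius invariant area, for which the disc of radius
  (1 - |z|)/2 about z has mass at least 1/36.\<close>

definition osc_density :: "(complex \<Rightarrow> complex) \<Rightarrow> complex \<Rightarrow> ennreal" where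
  "osc_density f z = mean_square_osc f z * ennreal (1 / (1 - (cmod z)\<^sup>2)\<^sup>2)"

lemma measurable_osc_density:
  "f \<in> H_infinity \<Longrightarrow> osc_density f \<in> borel_measurable (restrict_space borel disc)"
proof -
  assume f: "f \<in> H_infinity"
  note [measurable] = measurable_mean_square_osc[OF f]
  have [measurable]: "(\<lambda>w. w) \<in> borel_measurable (restrict_space borel disc)"
    by (simp add: measurable_restrict_space1)
  show ?thesis unfolding osc_density_def by measurable
qed

text \<open>For fixed \<zeta> the indicator cuts out a Stolz region of aperture \<beta>; for fixed
  \<open>z\<close> it cuts out an arc of length at most 24 \<beta> (1 - |z|). Integrating in \<zeta>
  first therefore reduces (1 - |z|^2)^-2 to (1 - |z|^2)^-1, up to a constant.\<close>

lemma AE_osc_density_cone_finite: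
  fixes \<beta> :: real
  assumes f: "f \<in> H_infinity" and \<beta>: "\<beta> > 0"
  shows "AE \<zeta> in circle_arc_length.
    (\<integral>\<^sup>+z. osc_density f z * indicator (ball z (\<beta> * (1 - cmod z))) \<zeta> \<partial>disc_area) \<noteq> \<infinity>"
proof (rule nn_integral_noteq_infinite)
  interpret D: prob_space disc_area by (rule prob_space_disc_area)
  interpret P: pair_sigma_finite disc_area circle_arc_length by (rule pair_sigma_finite_disc_circle)
  have mG[measurable]: "osc_density f \<in> borel_measurable disc_area"
    by (rule measurable_disc_areaI[OF measurable_osc_density[OF f]])
  \<comment> \<open>As a condition on the distance, the indicator is visibly measurable in both
    variables jointly.\<close>
  have ind: "indicator (ball z (\<beta> * (1 - cmod z))) \<zeta> = (if dist z \<zeta> < \<beta> * (1 - cmod z) then 1 else 0 :: ennreal)" for z \<zeta>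
    by simp
  have [measurable]: "(\<lambda>p. osc_density f (fst p)) \<in> borel_measurable (disc_area \<Otimes>\<^sub>M circle_arc_length)"
    "(\<lambda>p. osc_density f (snd p)) \<in> borel_measurable (circle_arc_length \<Otimes>\<^sub>M disc_area)"
    using measurable_compose[OF measurable_fst mG] measurable_compose[OF measurable_snd mG] by auto
  show "(\<lambda>\<zeta>. \<integral>\<^sup>+z. osc_density f z * indicator (ball z (\<beta> * (1 - cmod z))) \<zeta> \<partial>disc_area) \<in> borel_measurable circle_arc_length"
    unfolding ind by (rule D.borel_measurable_nn_integral) (unfold case_prod_beta, measurable)
  have "(\<integral>\<^sup>+\<zeta>. \<integral>\<^sup>+z. osc_density f z * indicator (ball z (\<beta> * (1 - cmod z))) \<zeta> \<partial>disc_area \<partial>circle_arc_length) =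
      (\<integral>\<^sup>+z. \<integral>\<^sup>+\<zeta>. osc_density f z * indicator (ball z (\<beta> * (1 - cmod z))) \<zeta> \<partial>circle_arc_length \<partial>disc_area)"
    unfolding ind by (rule P.Fubini') (unfold case_prod_beta, measurable)
  also have "\<dots> \<le> (\<integral>\<^sup>+z. ennreal (24 * \<beta>) * (mean_square_osc f z * ennreal (1 / (1 - (cmod z)\<^sup>2))) \<partial>disc_area)"
  proof (intro nn_integral_mono)
    fix z assume "z \<in> space disc_area"
    then have z: "cmod z < 1" by simp
    then have "(cmod z)\<^sup>2 < 1" by (simp add: abs_square_less_1)
    moreover have "1 - cmod z \<le> 1 - (cmod z)\<^sup>2"
      using z by (simp add: power2_eq_square mult_left_le)
    ultimately have z1: "(cmod z)\<^sup>2 < 1" "1 - cmod z \<le> 1 - (cmod z)\<^sup>2" .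
    have m: "indicator (ball z (\<beta> * (1 - cmod z))) \<in> borel_measurable circle_arc_length"
      by (intro measurable_compose[OF measurable_circle_id] borel_measurable_indicator) simp
    have "(\<integral>\<^sup>+\<zeta>. osc_density f z * indicator (ball z (\<beta> * (1 - cmod z))) \<zeta> \<partial>circle_arc_length) =
        osc_density f z * (\<integral>\<^sup>+\<zeta>. indicator (ball z (\<beta> * (1 - cmod z))) \<zeta> \<partial>circle_arc_length)"
      by (rule nn_integral_cmult[OF m])
    also have "\<dots> \<le> osc_density f z * ennreal (24 * (\<beta> * (1 - cmod z)))"
      using z \<beta> by (intro mult_left_mono nn_integral_circle_ball) auto
    also have "\<dots> = mean_square_osc f z * ennreal (24 * \<beta> * ((1 - cmod z) / (1 - (cmod z)\<^sup>2)\<^sup>2))"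
      using z \<beta> unfolding osc_density_def mult.assoc by (subst ennreal_mult[symmetric]) auto
    also have "\<dots> \<le> mean_square_osc f z * ennreal (24 * \<beta> * (1 / (1 - (cmod z)\<^sup>2)))"
    proof (intro mult_left_mono ennreal_leI)
      have "(1 - cmod z) / (1 - (cmod z)\<^sup>2)\<^sup>2 \<le> (1 - (cmod z)\<^sup>2) / (1 - (cmod z)\<^sup>2)\<^sup>2"
        using z1 by (intro divide_right_mono) auto
      also have "\<dots> = 1 / (1 - (cmod z)\<^sup>2)"
        using z1 by (simp add: power2_eq_square[of "1 - _"])
      finally show "(1 - cmod z) / (1 - (cmod z)\<^sup>2)\<^sup>2 \<le> 1 / (1 - (cmod z)\<^sup>2)" .
    qed (use \<beta> in auto)
    also have "\<dots> = ennreal (24 * \<beta>) * (mean_square_osc f z * ennreal (1 / (1 - (cmod z)\<^sup>2)))"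
      using \<beta> z1 by (subst ennreal_mult) (auto simp: mult_ac)
    finally show "(\<integral>\<^sup>+\<zeta>. osc_density f z * indicator (ball z (\<beta> * (1 - cmod z))) \<zeta> \<partial>circle_arc_length) \<le>
        ennreal (24 * \<beta>) * (mean_square_osc f z * ennreal (1 / (1 - (cmod z)\<^sup>2)))" .
  qed
  also have "\<dots> = ennreal (24 * \<beta>) * (\<integral>\<^sup>+z. mean_square_osc f z * ennreal (1 / (1 - (cmod z)\<^sup>2)) \<partial>disc_area)"
  proof (rule nn_integral_cmult)
    have [measurable]: "(\<lambda>w. w) \<in> borel_measurable disc_area" by (rule measurable_disc_area_id)
    note [measurable] = measurable_disc_areaI[OF measurable_mean_square_osc[OF f]]
    show "(\<lambda>z. mean_square_osc f z * ennreal (1 / (1 - (cmod z)\<^sup>2))) \<in> borel_measurable disc_area"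
      by measurable
  qed
  also have "\<dots> < \<infinity>"
    using mean_square_osc_weighted_finite[OF f] by (simp add: ennreal_mult_less_top)
  finally show "(\<integral>\<^sup>+\<zeta>. \<integral>\<^sup>+z. osc_density f z * indicator (ball z (\<beta> * (1 - cmod z))) \<zeta> \<partial>disc_area \<partial>circle_arc_length) \<noteq> \<infinity>"
    by simp
qed

section \<open>Comparison of nearby points\<close>

lemma ball_half_radius:
  assumes z: "z \<in> disc" and z': "z' \<in> ball z ((1 - cmod z) / 2)"
  shows "z' \<in> disc" "(1 - cmod z) / 2 \<le> 1 - cmod z'" "1 - (cmod z')\<^sup>2 \<le> 3 * (1 - cmod z)"
proof -
  have d: "\<bar>cmod z - cmod z'\<bar> < (1 - cmod z) / 2"
    using z' norm_triangle_ineq3[of z z'] by (simp add: dist_norm)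
  then have "cmod z' - cmod z < (1 - cmod z) / 2" by linarith
  then have "cmod z' \<le> cmod z + (1 - cmod z) / 2" by linarith
  with z show 1: "z' \<in> disc" and "(1 - cmod z) / 2 \<le> 1 - cmod z'"
    by (auto simp: field_simps)
  have "1 - (cmod z')\<^sup>2 = (1 - cmod z') * (1 + cmod z')"
    by (simp add: power2_eq_square algebra_simps)
  also have "\<dots> \<le> (1 - cmod z') * 2"
    using 1 by (intro mult_left_mono) auto
  also have "\<dots> \<le> 3 * (1 - cmod z)"
  proof -
    have "cmod z - cmod z' < (1 - cmod z) / 2" using d by linarith
    then show ?thesis by (simp add: field_simps)
  qed
  finally show "1 - (cmod z')\<^sup>2 \<le> 3 * (1 - cmod z)" .
qed

text \<open>Passing from \<open>z\<close> to \<open>z'\<close>, 1 - |z|^2 loses at most a factor 4.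
  Since |z - z'| < (1 - |z|)/2 \<le> |1 - \<open>cnj z * w\<close>|/2, the modulus |1 -
  \<open>cnj z * w\<close>| grows by at most 3/2. The kernels thus differ by a factor of at most 4
  (3/2)^2 = 9, and 81 is its square.\<close>

lemma berezin_density_doubling:
  assumes z: "z \<in> disc" and z': "z' \<in> ball z ((1 - cmod z) / 2)" and w: "w \<in> disc"
  shows "berezin_density z w \<le> 81 * berezin_density z' w"
proof -
  note b = ball_half_radius[OF z z']
  have "1 - (cmod z)\<^sup>2 = (1 - cmod z) * (1 + cmod z)"
    by (simp add: power2_eq_square algebra_simps)
  also have "\<dots> \<le> (1 - cmod z) * 2"
    using z by (intro mult_left_mono) auto
  also have "\<dots> \<le> 4 * ((1 - cmod z') * 1)"
    using b(2) by simp
  also have "\<dots> \<le> 4 * ((1 - cmod z') * (1 + cmod z'))"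
    using b(1) by (intro mult_left_mono) auto
  also have "\<dots> = 4 * (1 - (cmod z')\<^sup>2)"
    by (simp add: power2_eq_square algebra_simps)
  finally have n: "1 - (cmod z)\<^sup>2 \<le> 4 * (1 - (cmod z')\<^sup>2)" .
  have "cmod (1 - cnj z' * w) \<le> cmod (1 - cnj z * w) + cmod (cnj (z - z') * w)"
    using norm_triangle_ineq[of "1 - cnj z * w" "cnj (z - z') * w"] by (simp add: algebra_simps)
  also have "cmod (cnj (z - z') * w) \<le> (1 - cmod z) / 2 * 1"
    unfolding norm_mult complex_mod_cnj using z z' w by (intro mult_mono) (auto simp: dist_norm)
  also have "cmod (1 - cnj z * w) + (1 - cmod z) / 2 * 1 \<le> 3 / 2 * cmod (1 - cnj z * w)"
    using one_minus_cnj_mult_ge(1)[OF z w] by simp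
  finally have den: "cmod (1 - cnj z' * w) \<le> 3 / 2 * cmod (1 - cnj z * w)" by simp
  define A where "A = 1 - (cmod z)\<^sup>2"
  define A' where "A' = 1 - (cmod z')\<^sup>2"
  define d where "d = cmod (1 - cnj z * w)"
  define d' where "d' = cmod (1 - cnj z' * w)"
  have pos: "0 < d" "0 < d'" "0 \<le> A" "0 \<le> A'"
    using one_minus_cnj_mult_ge(2)[OF z w] one_minus_cnj_mult_ge(2)[OF b(1) w] z b(1)
    by (auto simp: d_def d'_def A_def A'_def power_le_one)
  have dd: "d'\<^sup>2 \<le> 9 / 4 * d\<^sup>2"
    using power_mono[OF den, of 2]
    by (simp add: d_def d'_def power_mult_distrib power_divide)
  have "A / d\<^sup>2 \<le> (4 * A') / (4 / 9 * d'\<^sup>2)"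
    using n pos dd by (intro frac_le) (auto simp: A_def A'_def)
  also have "\<dots> = 9 * (A' / d'\<^sup>2)"
    by simp
  finally have "A / d\<^sup>2 \<le> 9 * (A' / d'\<^sup>2)" .
  then have "(A / d\<^sup>2)\<^sup>2 \<le> (9 * (A' / d'\<^sup>2))\<^sup>2"
    using pos by (intro power_mono) auto
  moreover have "berezin_density z w = (A / d\<^sup>2)\<^sup>2" "berezin_density z' w = (A' / d'\<^sup>2)\<^sup>2"
    by (simp_all add: berezin_density_eq kernel_sqrt_def A_def A'_def d_def d'_def norm_divide norm_power
      power_divide power_one_over)
  moreover have "(9 * (A' / d'\<^sup>2))\<^sup>2 = 81 * (A' / d'\<^sup>2)\<^sup>2"
    by (subst power_mult_distrib) simp
  ultimately show ?thesis by (simp only:)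
qed

text \<open>The variance is the least second moment, so the centre \<open>f z\<close> may first be
  replaced by \<open>f z'\<close> under the density at \<open>z\<close>. Only then are the densities
  compared.\<close>

lemma mean_square_osc_doubling:
  assumes f: "f \<in> H_infinity" and z: "z \<in> disc" and z': "z' \<in> ball z ((1 - cmod z) / 2)"
  shows "mean_square_osc f z \<le> 81 * mean_square_osc f z'"
proof -
  have [measurable]: "(\<lambda>w. w) \<in> borel_measurable disc_area" by (rule measurable_disc_area_id)
  note [measurable] = measurable_disc_areaI[OF H_infinityD(3)[OF f]]
  have "mean_square_osc f z \<le> mean_square_osc f z + ennreal ((cmod (f z - f z'))\<^sup>2)"
    by simp
  also have "\<dots> = (\<integral>\<^sup>+w. ennreal ((cmod (f w - f z'))\<^sup>2 * berezin_density z w) \<partial>disc_area)"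
    by (rule mean_square_osc_variance[OF f z, symmetric])
  also have "\<dots> \<le> (\<integral>\<^sup>+w. 81 * ennreal ((cmod (f w - f z'))\<^sup>2 * berezin_density z' w) \<partial>disc_area)"
  proof (intro nn_integral_mono)
    fix w assume "w \<in> space disc_area"
    then have w: "w \<in> disc" by simp
    have "(cmod (f w - f z'))\<^sup>2 * berezin_density z w \<le> (cmod (f w - f z'))\<^sup>2 * (81 * berezin_density z' w)"
      by (intro mult_left_mono berezin_density_doubling[OF z z' w]) simp
    then show "ennreal ((cmod (f w - f z'))\<^sup>2 * berezin_density z w) \<le>
        81 * ennreal ((cmod (f w - f z'))\<^sup>2 * berezin_density z' w)"
      by (simp add: mult_ac flip: ennreal_mult ennreal_numeral)
  qed
  also have "\<dots> = 81 * mean_square_osc f z'"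
    unfolding mean_square_osc_def by (rule nn_integral_cmult) measurable
  finally show ?thesis .
qed

lemma nn_integral_disc_area_ball:
  assumes "ball z r \<subseteq> disc" "0 \<le> r"
  shows "(\<integral>\<^sup>+w. indicator (ball z r) w \<partial>disc_area) = ennreal (r\<^sup>2)"
proof -
  have "(\<integral>\<^sup>+w. indicator (ball z r) w \<partial>disc_area) =
      (\<integral>\<^sup>+w. indicator (ball z r) w * indicator disc w \<partial>lborel) / pi"
    by (rule nn_integral_disc_area) (intro measurable_restrict_space1 borel_measurable_indicator, simp)
  also have "(\<integral>\<^sup>+w. indicator (ball z r) w * indicator disc w \<partial>lborel) = (\<integral>\<^sup>+w. indicator (ball z r) w \<partial>lborel)"
    using assms(1) by (intro nn_integral_cong) (auto simp: indicator_def)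
  also have "\<dots> = ennreal (pi * r\<^sup>2)"
    using assms(2) by (simp add: emeasure_ball unit_ball_vol_2)
  also have "\<dots> / pi = ennreal (r\<^sup>2)"
    by (simp add: divide_ennreal)
  finally show ?thesis .
qed

text \<open>2916 = 81 * 9 * 4: the factor 81 is the doubling constant, 9 comes from 1 - |z'|^2 \<le>
  3s with s = 1 - |z|, and 4 from the normalized area s^2/4 of the disc of radius s/2.\<close>

lemma mean_square_osc_le_local_area:
  assumes f: "f \<in> H_infinity" and z: "z \<in> disc"
  shows "mean_square_osc f z \<le>
    2916 * (\<integral>\<^sup>+z'. osc_density f z' * indicator (ball z ((1 - cmod z) / 2)) z' \<partial>disc_area)"
proof -
  define s where "s = 1 - cmod z"
  have s: "s > 0" using z by (simp add: s_def)
  have sub: "ball z (s / 2) \<subseteq> disc"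
    using ball_half_radius(1)[OF z] unfolding s_def by blast
  have m: "(\<lambda>w. indicator (ball z (s / 2)) w :: ennreal) \<in> borel_measurable disc_area"
    by (intro measurable_compose[OF measurable_disc_area_id] borel_measurable_indicator) simp
  note [measurable] = m measurable_disc_areaI[OF measurable_osc_density[OF f]]
  have "mean_square_osc f z = 2916 * (mean_square_osc f z * ennreal (1 / 2916))"
  proof -
    have "2916 * (mean_square_osc f z * ennreal (1 / 2916)) = mean_square_osc f z * (ennreal 2916 * ennreal (1 / 2916))"
      by (simp add: mult_ac)
    also have "ennreal 2916 * ennreal (1 / 2916) = 1"
      by (subst ennreal_mult[symmetric]) auto
    finally show ?thesis by simp
  qed
  also have "mean_square_osc f z * ennreal (1 / 2916) =
      (\<integral>\<^sup>+z'. mean_square_osc f z * ennreal (1 / (81 * (9 * s\<^sup>2))) * indicator (ball z (s / 2)) z' \<partial>disc_area)"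
  proof -
    have "ennreal (1 / (81 * (9 * s\<^sup>2))) * ennreal ((s / 2)\<^sup>2) = ennreal (1 / 2916)"
      using s by (subst ennreal_mult[symmetric]) (auto simp: power_divide)
    moreover have "(\<integral>\<^sup>+w. indicator (ball z (s / 2)) w \<partial>disc_area) = ennreal ((s / 2)\<^sup>2)"
      using s by (intro nn_integral_disc_area_ball sub) simp
    ultimately show ?thesis
      by (subst nn_integral_cmult[OF m]) (simp only: mult.assoc)
  qed
  also have "\<dots> \<le> (\<integral>\<^sup>+z'. osc_density f z' * indicator (ball z (s / 2)) z' \<partial>disc_area)"
  proof (intro nn_integral_mono)
    fix z'
    show "mean_square_osc f z * ennreal (1 / (81 * (9 * s\<^sup>2))) * indicator (ball z (s / 2)) z' \<le>
        osc_density f z' * indicator (ball z (s / 2)) z'"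
    proof (cases "z' \<in> ball z (s / 2)")
      case True
      then have z': "z' \<in> ball z ((1 - cmod z) / 2)" by (simp add: s_def)
      note b = ball_half_radius[OF z z']
      have pos: "0 < 1 - (cmod z')\<^sup>2" using b(1) by (simp add: abs_square_less_1)
      have "(1 - (cmod z')\<^sup>2)\<^sup>2 \<le> (3 * s)\<^sup>2"
        using b(3) pos unfolding s_def by (intro power_mono) auto
      then have le: "1 / (9 * s\<^sup>2) \<le> 1 / (1 - (cmod z')\<^sup>2)\<^sup>2"
        using pos by (intro frac_le) (auto simp: power_mult_distrib)
      have "mean_square_osc f z * ennreal (1 / (81 * (9 * s\<^sup>2))) \<le>
          81 * mean_square_osc f z' * ennreal (1 / (81 * (9 * s\<^sup>2)))"
        by (intro mult_right_mono mean_square_osc_doubling[OF f z z']) simp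
      also have "\<dots> = mean_square_osc f z' * (ennreal 81 * ennreal (1 / (81 * (9 * s\<^sup>2))))"
        by (simp add: mult_ac)
      also have "ennreal 81 * ennreal (1 / (81 * (9 * s\<^sup>2))) = ennreal (1 / (9 * s\<^sup>2))"
        by (subst ennreal_mult[symmetric]) auto
      also have "mean_square_osc f z' * ennreal (1 / (9 * s\<^sup>2)) \<le> osc_density f z'"
        unfolding osc_density_def by (intro mult_left_mono ennreal_leI le) simp
      finally show ?thesis using True by simp
    qed simp
  qed
  finally show ?thesis
    unfolding s_def by (simp add: mult_left_mono)
qed

text \<open>The disc of radius (1 - |z|)/2 about a point of the Stolz region stays in a wider cone:
  its points satisfy |z' - \<zeta>| < (2\<alpha> + 1)(1 - |z|)/2 \<le> (2\<alpha> + 1)(1 - |z'|).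
  They also satisfy |z' - \<zeta>| < 2|z - \<zeta>|, so only the tail of the convergent cone
  integral near \<zeta> is involved.\<close>

lemma mean_square_osc_tendsto_0:
  assumes f: "f \<in> H_infinity" and \<zeta>: "cmod \<zeta> = 1" and \<alpha>: "\<alpha> > 1" and \<beta>: "2 * \<alpha> + 1 \<le> \<beta>"
    and fin: "(\<integral>\<^sup>+z. osc_density f z * indicator (ball z (\<beta> * (1 - cmod z))) \<zeta> \<partial>disc_area) \<noteq> \<infinity>"
  shows "(mean_square_osc f \<longlongrightarrow> 0) (at \<zeta> within stolz_region \<alpha> \<zeta>)"
proof -
  define C where "C z = osc_density f z * indicator (ball z (\<beta> * (1 - cmod z))) \<zeta>" for z
  \<comment> \<open>The part of the cone integral within 1/(k + 1) of \<zeta>. It tends to 0 by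
    dominated convergence, since every point of the disc has positive distance from \<zeta>.\<close>
  define J where "J k = (\<integral>\<^sup>+z. C z * indicator (ball \<zeta> (1 / Suc k)) z \<partial>disc_area)" for k
  have id[measurable]: "(\<lambda>w. w) \<in> borel_measurable disc_area" by (rule measurable_disc_area_id)
  note [measurable] = measurable_disc_areaI[OF measurable_osc_density[OF f]]
  have ind: "indicator (ball z (\<beta> * (1 - cmod z))) \<zeta> = (if dist z \<zeta> < \<beta> * (1 - cmod z) then 1 else 0 :: ennreal)" for z
    by simp
  have [measurable]: "C \<in> borel_measurable disc_area"
    unfolding C_def ind by measurable
  have m: "(\<lambda>z. indicator (ball \<zeta> r) z :: ennreal) \<in> borel_measurable disc_area" for r
    by (intro measurable_compose[OF id] borel_measurable_indicator) simp
  note [measurable] = m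
  have "J \<longlonglongrightarrow> (\<integral>\<^sup>+z. 0 \<partial>disc_area)"
    unfolding J_def
  proof (rule nn_integral_dominated_convergence[where w = C])
    show "(\<integral>\<^sup>+z. C z \<partial>disc_area) < \<infinity>"
      using fin unfolding C_def by (simp add: less_top)
    show "AE z in disc_area. C z * indicator (ball \<zeta> (1 / Suc k)) z \<le> C z" for k
      by (intro AE_I2) (simp split: split_indicator)
    show "AE z in disc_area. (\<lambda>k. C z * indicator (ball \<zeta> (1 / Suc k)) z) \<longlonglongrightarrow> 0"
    proof (intro AE_I2)
      fix z assume "z \<in> space disc_area"
      then have "0 < dist \<zeta> z" using \<zeta> by auto
      then obtain N where N: "1 / Suc N < dist \<zeta> z" by (rule nat_approx_posE)
      have "C z * indicator (ball \<zeta> (1 / Suc k)) z = 0" if "k \<ge> N" for k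
      proof -
        have "1 / Suc k \<le> 1 / Suc N" using that by (intro frac_le) auto
        then show ?thesis using N by simp
      qed
      then show "(\<lambda>k. C z * indicator (ball \<zeta> (1 / Suc k)) z) \<longlonglongrightarrow> 0"
        by (intro tendsto_eventually eventually_sequentiallyI) auto
    qed
  qed auto
  then have J: "J \<longlonglongrightarrow> 0" by simp
  have bound: "mean_square_osc f z \<le> 2916 * J k"
    if z: "z \<in> stolz_region \<alpha> \<zeta>" and d: "dist z \<zeta> < 1 / (2 * Suc k)" for z k
  proof -
    have zd: "z \<in> disc" and za: "cmod (z - \<zeta>) < \<alpha> * (1 - cmod z)"
      using z by (auto simp: stolz_region_def)
    have s: "1 - cmod z \<le> dist z \<zeta>"
      using norm_triangle_ineq2[of \<zeta> z] \<zeta> by (simp add: dist_norm norm_minus_commute)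
    have "mean_square_osc f z \<le>
        2916 * (\<integral>\<^sup>+z'. osc_density f z' * indicator (ball z ((1 - cmod z) / 2)) z' \<partial>disc_area)"
      by (rule mean_square_osc_le_local_area[OF f zd])
    also have "\<dots> \<le> 2916 * J k"
      unfolding J_def
    proof (intro mult_left_mono nn_integral_mono)
      fix z'
      show "osc_density f z' * indicator (ball z ((1 - cmod z) / 2)) z' \<le> C z' * indicator (ball \<zeta> (1 / Suc k)) z'"
      proof (cases "z' \<in> ball z ((1 - cmod z) / 2)")
        case True
        note b = ball_half_radius[OF zd True]
        have t: "dist z' \<zeta> < (1 - cmod z) / 2 + dist z \<zeta>"
          using dist_triangle[of z' \<zeta> z] True by (simp add: dist_commute field_simps)
        have "dist z' \<zeta> < 2 * dist z \<zeta>"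
          using t s zd by (simp add: field_simps)
        also have "\<dots> \<le> 1 / Suc k"
          using d by (simp add: field_simps)
        finally have 1: "z' \<in> ball \<zeta> (1 / Suc k)" by (simp add: dist_commute)
        have "dist z' \<zeta> < (1 - cmod z) / 2 + \<alpha> * (1 - cmod z)"
          using t za by (simp add: dist_norm)
        also have "\<dots> = (2 * \<alpha> + 1) * ((1 - cmod z) / 2)"
          by (simp add: field_simps)
        also have "\<dots> \<le> \<beta> * (1 - cmod z')"
          using \<alpha> \<beta> b zd by (intro mult_mono) auto
        finally have "\<zeta> \<in> ball z' (\<beta> * (1 - cmod z'))" by simp
        with 1 True show ?thesis by (simp add: C_def)
      qed simp
    qed simp
    finally show ?thesis .
  qed
  show ?thesis
  proof (rule order_tendstoI)
    fix a :: ennreal assume a: "0 < a"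
    have "(\<lambda>k. 2916 * J k) \<longlonglongrightarrow> 2916 * 0"
      by (intro ennreal_tendsto_cmult J) simp
    then have "eventually (\<lambda>k. 2916 * J k < a) sequentially"
      using a by (intro order_tendstoD(2)) auto
    then obtain k where k: "2916 * J k < a" by (auto simp: eventually_sequentially)
    show "eventually (\<lambda>z. mean_square_osc f z < a) (at \<zeta> within stolz_region \<alpha> \<zeta>)"
      unfolding eventually_at
      by (intro exI[of _ "1 / (2 * Suc k)"]) (auto intro: le_less_trans[OF bound k])
  qed simp
qed

subsection \<open>The algebra of functions with vanishing oscillation\<close>

definition mean_osc :: "(complex \<Rightarrow> complex) \<Rightarrow> complex \<Rightarrow> ennreal" where
  "mean_osc u z = (\<integral>\<^sup>+w. ennreal (cmod (u w - u z) * berezin_density z w) \<partial>disc_area)"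

text \<open>The quantifier over \<alpha> stands inside, so that one exceptional null set serves all
  apertures, as \<open>has_nontangential_limit\<close> demands.\<close>

definition vanishing_osc :: "(complex \<Rightarrow> complex) \<Rightarrow> bool" where
  "vanishing_osc u \<longleftrightarrow>
     (AE \<zeta> in circle_arc_length. \<forall>\<alpha>>1. (mean_osc u \<longlongrightarrow> 0) (at \<zeta> within stolz_region \<alpha> \<zeta>))"

lemma nn_integral_berezin_density:
  assumes "z \<in> disc"
  shows "(\<integral>\<^sup>+w. ennreal (berezin_density z w) \<partial>disc_area) = 1"
  using nn_integral_eq_integral[OF integral_berezin_density(1)[OF assms]] integral_berezin_density(2)[OF assms]
  by simp

lemma measurable_osc_integrand:
  assumes "continuous_on disc u" "z \<in> disc"
  shows "(\<lambda>w. ennreal (cmod (u w - c) * berezin_density z w)) \<in> borel_measurable disc_area"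
  by (intro measurable_disc_areaI measurable_compose[OF _ measurable_ennreal]
      borel_measurable_continuous_on_restrict continuous_intros assms continuous_on_berezin_density)

lemma eventually_stolz_region_disc: "eventually (\<lambda>z. z \<in> disc) (at \<zeta> within stolz_region \<alpha> \<zeta>)"
  by (auto simp: eventually_at_filter stolz_region_def)

text \<open>In place of Cauchy-Schwarz and a square root in \<open>ennreal\<close>: t \<le> e +
  t^2/e for t \<ge> 0, because (e - t)^2 + e t \<ge> 0. The density has mass 1, and \<open>e\<close>
  is free to be chosen small.\<close>

lemma mean_osc_le_mean_square_osc:
  assumes f: "f \<in> H_infinity" and z: "z \<in> disc" and e: "0 < (e::real)"
  shows "mean_osc f z \<le> ennreal e + ennreal (1 / e) * mean_square_osc f z"
proof -
  have sq: "(\<lambda>w. ennreal ((cmod (f w - f z))\<^sup>2 * berezin_density z w)) \<in> borel_measurable disc_area"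
    using H_infinityD(2)[OF f] z
    by (intro measurable_disc_areaI measurable_compose[OF _ measurable_ennreal]
      borel_measurable_continuous_on_restrict continuous_intros continuous_on_berezin_density)
  have kd: "(\<lambda>w. ennreal (berezin_density z w)) \<in> borel_measurable disc_area"
    using z by (intro measurable_disc_areaI measurable_compose[OF _ measurable_ennreal]
      borel_measurable_continuous_on_restrict continuous_on_berezin_density)
  have "mean_osc f z \<le> (\<integral>\<^sup>+w. ennreal e * ennreal (berezin_density z w) +
      ennreal (1 / e) * ennreal ((cmod (f w - f z))\<^sup>2 * berezin_density z w) \<partial>disc_area)"
    unfolding mean_osc_def
  proof (intro nn_integral_mono)
    fix w
    define t where "t = cmod (f w - f z)"
    have "0 \<le> t" by (simp add: t_def)
    have "0 \<le> (e - t)\<^sup>2 + e * t" using e \<open>0 \<le> t\<close> by simp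
    then have "t * e \<le> e * e + t * t"
      by (simp add: power2_eq_square algebra_simps)
    also have "\<dots> = (e + 1 / e * t\<^sup>2) * e"
      using e by (simp add: ring_distribs power2_eq_square)
    finally have "t * e \<le> (e + 1 / e * t\<^sup>2) * e" .
    then have "t \<le> e + 1 / e * t\<^sup>2"
      using e by simp
    then have "t * berezin_density z w \<le> (e + 1 / e * t\<^sup>2) * berezin_density z w"
      by (intro mult_right_mono) auto
    then have "ennreal (t * berezin_density z w) \<le> ennreal (e * berezin_density z w + 1 / e * (t\<^sup>2 * berezin_density z w))"
      by (intro ennreal_leI) (simp add: ring_distribs)
    also have "\<dots> = ennreal (e * berezin_density z w) + ennreal (1 / e * (t\<^sup>2 * berezin_density z w))"
      using e by (intro ennreal_plus) auto
    also have "\<dots> = ennreal e * ennreal (berezin_density z w) + ennreal (1 / e) * ennreal (t\<^sup>2 * berezin_density z w)"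
      using e by (intro arg_cong2[of _ _ _ _ "(+)"] ennreal_mult) auto
    finally show "ennreal (cmod (f w - f z) * berezin_density z w) \<le> ennreal e * ennreal (berezin_density z w) +
        ennreal (1 / e) * ennreal ((cmod (f w - f z))\<^sup>2 * berezin_density z w)"
      by (simp only: t_def)
  qed
  also have "\<dots> = ennreal e * (\<integral>\<^sup>+w. ennreal (berezin_density z w) \<partial>disc_area) + ennreal (1 / e) * mean_square_osc f z"
    unfolding mean_square_osc_def nn_integral_cmult[OF kd, symmetric] nn_integral_cmult[OF sq, symmetric]
    by (intro nn_integral_add borel_measurable_times_ennreal borel_measurable_const kd sq)
  finally show ?thesis by (simp add: nn_integral_berezin_density[OF z])
qed

lemma ennreal_gt_0_obtain_real:
  fixes a :: ennreal
  assumes "0 < a"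
  obtains e :: real where "0 < e" "ennreal e < a"
proof (cases a)
  case (real r)
  with assms show ?thesis by (intro that[of "r / 2"]) (auto simp: ennreal_less_iff)
next
  case top
  then show ?thesis by (intro that[of 1]) auto
qed

lemma vanishing_osc_H_infinity:
  assumes f: "f \<in> H_infinity"
  shows "vanishing_osc f"
proof -
  \<comment> \<open>Integer apertures are enough, since each \<alpha> only requires some \<beta>
    \<ge> 2\<alpha> + 1. Countably many exceptional sets then merge into one null set.\<close>
  have "AE \<zeta> in circle_arc_length. \<forall>m::nat.
      (\<integral>\<^sup>+z. osc_density f z * indicator (ball z (real (Suc m) * (1 - cmod z))) \<zeta> \<partial>disc_area) \<noteq> \<infinity>"
    unfolding AE_all_countable by (intro allI AE_osc_density_cone_finite[OF f]) simp
  then show ?thesis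
    unfolding vanishing_osc_def
  proof (rule AE_mp, intro AE_I2 impI allI)
    fix \<zeta> and \<alpha> :: real
    assume \<zeta>: "\<zeta> \<in> space circle_arc_length" and \<alpha>: "1 < \<alpha>"
      and fin: "\<forall>m::nat. (\<integral>\<^sup>+z. osc_density f z * indicator (ball z (real (Suc m) * (1 - cmod z))) \<zeta> \<partial>disc_area) \<noteq> \<infinity>"
    obtain m :: nat where m: "2 * \<alpha> + 1 \<le> real m" using real_arch_simple by blast
    have lim: "(mean_square_osc f \<longlongrightarrow> 0) (at \<zeta> within stolz_region \<alpha> \<zeta>)"
      by (rule mean_square_osc_tendsto_0[OF f _ \<alpha> _ fin[rule_format, of m]]) (use \<zeta> m in auto)
    show "(mean_osc f \<longlongrightarrow> 0) (at \<zeta> within stolz_region \<alpha> \<zeta>)"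
    proof (rule order_tendstoI)
      fix a :: ennreal assume "0 < a"
      then obtain e :: real where e: "0 < e" "ennreal e < a"
        by (rule ennreal_gt_0_obtain_real)
      have "((\<lambda>z. ennreal e + ennreal (1 / e) * mean_square_osc f z) \<longlongrightarrow> ennreal e + ennreal (1 / e) * 0)
          (at \<zeta> within stolz_region \<alpha> \<zeta>)"
        by (intro tendsto_add ennreal_tendsto_cmult tendsto_const lim) simp
      then have "eventually (\<lambda>z. ennreal e + ennreal (1 / e) * mean_square_osc f z < a) (at \<zeta> within stolz_region \<alpha> \<zeta>)"
        using e by (intro order_tendstoD(2)) auto
      with eventually_stolz_region_disc show "eventually (\<lambda>z. mean_osc f z < a) (at \<zeta> within stolz_region \<alpha> \<zeta>)"
        by eventually_elim (use mean_osc_le_mean_square_osc[OF f _ e(1)] in \<open>auto intro: le_less_trans\<close>)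
    qed simp
  qed
qed

section \<open>Closure of vanishing oscillation under algebra operations and uniform limits\<close>

lemma vanishing_osc_dominated:
  assumes g: "vanishing_osc g" and h: "vanishing_osc h"
    and le: "\<And>z. z \<in> disc \<Longrightarrow> mean_osc u z \<le> ennreal a * mean_osc g z + ennreal b * mean_osc h z"
  shows "vanishing_osc u"
proof -
  have "AE \<zeta> in circle_arc_length. \<forall>\<alpha>>1. (mean_osc g \<longlongrightarrow> 0) (at \<zeta> within stolz_region \<alpha> \<zeta>)"
    "AE \<zeta> in circle_arc_length. \<forall>\<alpha>>1. (mean_osc h \<longlongrightarrow> 0) (at \<zeta> within stolz_region \<alpha> \<zeta>)"
    using g h by (auto simp: vanishing_osc_def)
  then show ?thesis
    unfolding vanishing_osc_def
  proof (eventually_elim, intro allI impI)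
    fix \<zeta> and \<alpha> :: real
    assume gh: "\<forall>\<alpha>>1. (mean_osc g \<longlongrightarrow> 0) (at \<zeta> within stolz_region \<alpha> \<zeta>)"
      "\<forall>\<alpha>>1. (mean_osc h \<longlongrightarrow> 0) (at \<zeta> within stolz_region \<alpha> \<zeta>)" and \<alpha>: "1 < \<alpha>"
    have "((\<lambda>z. ennreal a * mean_osc g z + ennreal b * mean_osc h z) \<longlongrightarrow> ennreal a * 0 + ennreal b * 0)
        (at \<zeta> within stolz_region \<alpha> \<zeta>)"
      using gh \<alpha> by (intro tendsto_add ennreal_tendsto_cmult) auto
    then have lim: "((\<lambda>z. ennreal a * mean_osc g z + ennreal b * mean_osc h z) \<longlongrightarrow> 0)
        (at \<zeta> within stolz_region \<alpha> \<zeta>)"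
      by simp
    show "(mean_osc u \<longlongrightarrow> 0) (at \<zeta> within stolz_region \<alpha> \<zeta>)"
    proof (rule tendsto_sandwich[OF _ _ tendsto_const lim])
      show "eventually (\<lambda>z. mean_osc u z \<le> ennreal a * mean_osc g z + ennreal b * mean_osc h z)
          (at \<zeta> within stolz_region \<alpha> \<zeta>)"
        using eventually_stolz_region_disc by eventually_elim (rule le)
    qed simp
  qed
qed

lemma mean_osc_lincomb_le:
  assumes g: "continuous_on disc g" and h: "continuous_on disc h" and z: "z \<in> disc" and ab: "0 \<le> a" "0 \<le> b"
    and le: "\<And>w. w \<in> disc \<Longrightarrow> cmod (u w - u z) \<le> a * cmod (g w - g z) + b * cmod (h w - h z)"
  shows "mean_osc u z \<le> ennreal a * mean_osc g z + ennreal b * mean_osc h z"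
proof -
  note m = measurable_osc_integrand[OF g z, of "g z"] measurable_osc_integrand[OF h z, of "h z"]
  have "mean_osc u z \<le> (\<integral>\<^sup>+w. ennreal a * ennreal (cmod (g w - g z) * berezin_density z w) +
      ennreal b * ennreal (cmod (h w - h z) * berezin_density z w) \<partial>disc_area)"
    unfolding mean_osc_def
  proof (intro nn_integral_mono)
    fix w assume "w \<in> space disc_area"
    then have "cmod (u w - u z) * berezin_density z w \<le>
        (a * cmod (g w - g z) + b * cmod (h w - h z)) * berezin_density z w"
      by (intro mult_right_mono le) auto
    then have "ennreal (cmod (u w - u z) * berezin_density z w) \<le>
        ennreal (a * (cmod (g w - g z) * berezin_density z w) + b * (cmod (h w - h z) * berezin_density z w))"
      by (intro ennreal_leI) (simp add: ring_distribs)
    also have "\<dots> = ennreal a * ennreal (cmod (g w - g z) * berezin_density z w) +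
        ennreal b * ennreal (cmod (h w - h z) * berezin_density z w)"
      using ab by (subst ennreal_plus) (auto simp: ennreal_mult)
    finally show "ennreal (cmod (u w - u z) * berezin_density z w) \<le>
        ennreal a * ennreal (cmod (g w - g z) * berezin_density z w) +
        ennreal b * ennreal (cmod (h w - h z) * berezin_density z w)" .
  qed
  also have "\<dots> = ennreal a * mean_osc g z + ennreal b * mean_osc h z"
    unfolding mean_osc_def nn_integral_cmult[OF m(1), symmetric] nn_integral_cmult[OF m(2), symmetric]
    by (intro nn_integral_add borel_measurable_times_ennreal borel_measurable_const m)
  finally show ?thesis .
qed

text \<open>The error enters twice, at \<open>w\<close> and at the centre \<open>z\<close>, and is
  integrated against a density of mass 1.\<close>

lemma mean_osc_uniform_approx:
  assumes g: "continuous_on disc g" and z: "z \<in> disc" and e: "0 \<le> (e::real)"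
    and le: "\<And>w. w \<in> disc \<Longrightarrow> cmod (u w - g w) \<le> e"
  shows "mean_osc u z \<le> mean_osc g z + ennreal (2 * e)"
proof -
  note m = measurable_osc_integrand[OF g z, of "g z"]
  have kd: "(\<lambda>w. ennreal (berezin_density z w)) \<in> borel_measurable disc_area"
    using z by (intro measurable_disc_areaI measurable_compose[OF _ measurable_ennreal]
      borel_measurable_continuous_on_restrict continuous_on_berezin_density)
  have "mean_osc u z \<le> (\<integral>\<^sup>+w. ennreal (cmod (g w - g z) * berezin_density z w) +
      ennreal (2 * e) * ennreal (berezin_density z w) \<partial>disc_area)"
    unfolding mean_osc_def
  proof (intro nn_integral_mono)
    fix w assume "w \<in> space disc_area"
    then have w: "w \<in> disc" by simp
    have "cmod (u w - u z) \<le> cmod (g w - g z) + cmod ((u w - g w) - (u z - g z))"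
      using norm_triangle_ineq[of "g w - g z" "(u w - g w) - (u z - g z)"] by simp
    also have "cmod ((u w - g w) - (u z - g z)) \<le> e + e"
      using norm_triangle_ineq4[of "u w - g w" "u z - g z"] le[OF w] le[OF z] by linarith
    finally have "cmod (u w - u z) * berezin_density z w \<le> (cmod (g w - g z) + (e + e)) * berezin_density z w"
      by (intro mult_right_mono) auto
    then have "ennreal (cmod (u w - u z) * berezin_density z w) \<le>
        ennreal (cmod (g w - g z) * berezin_density z w + 2 * e * berezin_density z w)"
      by (intro ennreal_leI) (simp add: ring_distribs)
    also have "\<dots> = ennreal (cmod (g w - g z) * berezin_density z w) + ennreal (2 * e) * ennreal (berezin_density z w)"
      using e by (subst ennreal_plus) (auto simp: ennreal_mult)
    finally show "ennreal (cmod (u w - u z) * berezin_density z w) \<le>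
        ennreal (cmod (g w - g z) * berezin_density z w) + ennreal (2 * e) * ennreal (berezin_density z w)" .
  qed
  also have "\<dots> = mean_osc g z + ennreal (2 * e)"
    unfolding mean_osc_def
    by (subst nn_integral_add)
      (simp_all add: m kd borel_measurable_times_ennreal nn_integral_cmult nn_integral_berezin_density[OF z])
  finally show ?thesis .
qed

lemma vanishing_osc_uniform_limit:
  assumes G: "\<And>n::nat. continuous_on disc (G n)" "\<And>n. vanishing_osc (G n)"
    and lim: "\<And>e. 0 < e \<Longrightarrow> \<exists>n. \<forall>w\<in>disc. cmod (u w - G n w) \<le> e"
  shows "vanishing_osc u"
proof -
  \<comment> \<open>The approximating sequence is countable, so a single null set works for all of
    its members.\<close>
  have "AE \<zeta> in circle_arc_length. \<forall>n. \<forall>\<alpha>>1. (mean_osc (G n) \<longlongrightarrow> 0) (at \<zeta> within stolz_region \<alpha> \<zeta>)"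
    using G(2) unfolding AE_all_countable vanishing_osc_def by blast
  then show ?thesis
    unfolding vanishing_osc_def
  proof (eventually_elim, intro allI impI)
    fix \<zeta> and \<alpha> :: real
    assume 1: "\<forall>n. \<forall>\<alpha>>1. (mean_osc (G n) \<longlongrightarrow> 0) (at \<zeta> within stolz_region \<alpha> \<zeta>)" and \<alpha>: "1 < \<alpha>"
    show "(mean_osc u \<longlongrightarrow> 0) (at \<zeta> within stolz_region \<alpha> \<zeta>)"
    proof (rule order_tendstoI)
      fix a :: ennreal assume "0 < a"
      then obtain e :: real where e: "0 < e" "ennreal e < a"
        by (rule ennreal_gt_0_obtain_real)
      obtain n where n: "\<And>w. w \<in> disc \<Longrightarrow> cmod (u w - G n w) \<le> e / 2"
        using lim[of "e / 2"] e by (metis half_gt_zero)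
      have "((\<lambda>z. mean_osc (G n) z + ennreal e) \<longlongrightarrow> 0 + ennreal e) (at \<zeta> within stolz_region \<alpha> \<zeta>)"
        using 1 \<alpha> by (intro tendsto_add tendsto_const) auto
      then have "eventually (\<lambda>z. mean_osc (G n) z + ennreal e < a) (at \<zeta> within stolz_region \<alpha> \<zeta>)"
        using e by (intro order_tendstoD(2)) auto
      with eventually_stolz_region_disc show "eventually (\<lambda>z. mean_osc u z < a) (at \<zeta> within stolz_region \<alpha> \<zeta>)"
      proof eventually_elim
        case (elim z)
        have "mean_osc u z \<le> mean_osc (G n) z + ennreal (2 * (e / 2))"
          by (rule mean_osc_uniform_approx[OF G(1) elim(1) _ n]) (use e in auto)
        with elim(2) show ?case by (simp add: le_less_trans)
      qed
    qed simp
  qed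
qed

text \<open>A norm closed algebra is saturated under equality almost everywhere, while oscillation
  reads the value at \<open>z\<close>; the condition is therefore put on a continuous
  representative. Its boundedness supplies the constants in the product estimate.\<close>

lemma cstar_subalgebra_vanishing_osc:
  "cstar_subalgebra {f \<in> L_infinity. \<exists>g. continuous_on disc g \<and> bounded (g ` disc) \<and> vanishing_osc g \<and>
     (AE w in disc_area. f w = g w)}"
    (is "cstar_subalgebra ?A")
proof -
  define R where "R f g \<longleftrightarrow> continuous_on disc g \<and> bounded (g ` disc) \<and> vanishing_osc g \<and>
     (AE w in disc_area. f w = g w)" for f g :: "complex \<Rightarrow> complex"
  have A: "f \<in> ?A \<longleftrightarrow> f \<in> L_infinity \<and> (\<exists>g. R f g)" for f
    by (simp add: R_def)
  \<comment> \<open>The larger algebra of functions with continuous representatives already provides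
    membership in \<open>L_infinity\<close> and the continuous limit; only oscillation and
    boundedness are left to check.\<close>
  note B = cstar_subalgebra_continuous_rep[unfolded cstar_subalgebra_def]
  have AB: "f \<in> {f \<in> L_infinity. \<exists>g. continuous_on disc g \<and> (AE w in disc_area. f w = g w)}" if "f \<in> ?A" for f
    using that by auto
  have c: "(\<lambda>_. c) \<in> ?A" for c
  proof -
    have "R (\<lambda>_. c) (\<lambda>_. c)"
      using vanishing_osc_H_infinity[OF const_H_infinity[of c]] by (auto simp: R_def bounded_iff)
    moreover have "(\<lambda>_. c) \<in> L_infinity"
      using const_H_infinity[of c] H_infinity_continuous_rep by auto
    ultimately show ?thesis unfolding A by blast
  qed
  have add: "(\<lambda>w. f w + g w) \<in> ?A" if fg: "f \<in> ?A" "g \<in> ?A" for f g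
  proof -
    obtain f' g' where R: "R f f'" "R g g'" using fg unfolding A by blast
    have "R (\<lambda>w. f w + g w) (\<lambda>w. f' w + g' w)"
      unfolding R_def
    proof (intro conjI)
      show "vanishing_osc (\<lambda>w. f' w + g' w)"
      proof (rule vanishing_osc_dominated[of f' g' _ 1 1])
        show "mean_osc (\<lambda>w. f' w + g' w) z \<le> ennreal 1 * mean_osc f' z + ennreal 1 * mean_osc g' z"
          if "z \<in> disc" for z
        proof (rule mean_osc_lincomb_le)
          show "cmod (f' w + g' w - (f' z + g' z)) \<le> 1 * cmod (f' w - f' z) + 1 * cmod (g' w - g' z)" for w
            using norm_triangle_ineq[of "f' w - f' z" "g' w - g' z"] by (simp add: algebra_simps)
        qed (use R that in \<open>auto simp: R_def\<close>)
      qed (use R in \<open>auto simp: R_def\<close>)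
      have "AE w in disc_area. f w = f' w" "AE w in disc_area. g w = g' w"
        using R by (auto simp: R_def)
      then show "AE w in disc_area. f w + g w = f' w + g' w"
        by eventually_elim simp
    qed (use R in \<open>auto simp: R_def intro!: continuous_intros bounded_plus_comp\<close>)
    moreover have "(\<lambda>w. f w + g w) \<in> L_infinity"
      using B AB[OF fg(1)] AB[OF fg(2)] by blast
    ultimately show ?thesis unfolding A by blast
  qed
  have mult: "(\<lambda>w. f w * g w) \<in> ?A" if fg: "f \<in> ?A" "g \<in> ?A" for f g
  proof -
    obtain f' g' where R: "R f f'" "R g g'" using fg unfolding A by blast
    obtain C where C: "\<And>w. w \<in> disc \<Longrightarrow> cmod (f' w) \<le> C" using R(1) unfolding R_def bounded_iff by (metis imageI)
    obtain D where D: "\<And>w. w \<in> disc \<Longrightarrow> cmod (g' w) \<le> D" using R(2) unfolding R_def bounded_iff by (metis imageI)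
    have CD: "0 \<le> C" "0 \<le> D"
      using order_trans[OF norm_ge_zero C[of 0]] order_trans[OF norm_ge_zero D[of 0]] by simp_all
    have "R (\<lambda>w. f w * g w) (\<lambda>w. f' w * g' w)"
      unfolding R_def
    proof (intro conjI)
      show "vanishing_osc (\<lambda>w. f' w * g' w)"
      \<comment> \<open>The factors cross over: the oscillation of \<open>f'\<close> is weighted by
        the bound of \<open>g'\<close>, and conversely.\<close>
      proof (rule vanishing_osc_dominated[of f' g' _ D C])
        show "mean_osc (\<lambda>w. f' w * g' w) z \<le> ennreal D * mean_osc f' z + ennreal C * mean_osc g' z"
          if z: "z \<in> disc" for z
        proof (rule mean_osc_lincomb_le)
          fix w assume w: "w \<in> disc"
          have "cmod (f' w * g' w - f' z * g' z) = cmod ((f' w - f' z) * g' w + f' z * (g' w - g' z))"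
            by (simp add: algebra_simps)
          also have "\<dots> \<le> cmod (g' w) * cmod (f' w - f' z) + cmod (f' z) * cmod (g' w - g' z)"
            by (rule order_trans[OF norm_triangle_ineq]) (simp add: norm_mult)
          also have "\<dots> \<le> D * cmod (f' w - f' z) + C * cmod (g' w - g' z)"
            by (intro add_mono mult_right_mono C D w z) auto
          finally show "cmod (f' w * g' w - f' z * g' z) \<le> D * cmod (f' w - f' z) + C * cmod (g' w - g' z)" .
        qed (use R z CD in \<open>auto simp: R_def\<close>)
      qed (use R in \<open>auto simp: R_def\<close>)
      have "AE w in disc_area. f w = f' w" "AE w in disc_area. g w = g' w"
        using R by (auto simp: R_def)
      then show "AE w in disc_area. f w * g w = f' w * g' w"
        by eventually_elim simp
      have "cmod (f' w * g' w) \<le> C * D" if "w \<in> disc" for w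
        unfolding norm_mult using C D that CD by (intro mult_mono) auto
      then show "bounded ((\<lambda>w. f' w * g' w) ` disc)"
        unfolding bounded_iff by blast
    qed (use R in \<open>auto simp: R_def intro!: continuous_intros\<close>)
    moreover have "(\<lambda>w. f w * g w) \<in> L_infinity"
      using B AB[OF fg(1)] AB[OF fg(2)] by blast
    ultimately show ?thesis unfolding A by blast
  qed
  have conj: "(\<lambda>w. cnj (f w)) \<in> ?A" if f: "f \<in> ?A" for f
  proof -
    obtain f' where R: "R f f'" using f unfolding A by blast
    have "mean_osc (\<lambda>w. cnj (f' w)) = mean_osc f'"
      by (simp add: fun_eq_iff mean_osc_def flip: complex_cnj_diff)
    then have "R (\<lambda>w. cnj (f w)) (\<lambda>w. cnj (f' w))"
      using R by (auto simp: R_def vanishing_osc_def bounded_iff intro!: continuous_intros elim: eventually_mono)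
    moreover have "(\<lambda>w. cnj (f w)) \<in> L_infinity"
      using B AB[OF f] by blast
    ultimately show ?thesis unfolding A by blast
  qed
  have closed: "f \<in> ?A"
    if f: "f \<in> L_infinity" and F: "\<And>n::nat. F n \<in> ?A"
      and lim: "(\<lambda>n. Linf_norm (\<lambda>w. F n w - f w)) \<longlonglongrightarrow> 0" for F f
  proof -
    have "f \<in> {f \<in> L_infinity. \<exists>g. continuous_on disc g \<and> (AE w in disc_area. f w = g w)}"
      using B f AB[OF F] lim by blast
    then obtain g where g: "continuous_on disc g" "AE w in disc_area. f w = g w" by blast
    from F have "\<exists>g. R (F n) g" for n unfolding A by blast
    then obtain G where G: "\<And>n. R (F n) (G n)" by metis
    have "vanishing_osc g"
    proof (rule vanishing_osc_uniform_limit[of G])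
      fix e :: real assume "0 < e"
      then have "\<forall>\<^sub>F n in sequentially. Linf_norm (\<lambda>w. F n w - f w) < ereal e"
        by (intro order_tendstoD(2)[OF lim]) (auto simp: zero_ereal_def)
      then obtain n where "Linf_norm (\<lambda>w. F n w - f w) \<le> ereal e"
        by (auto simp: eventually_sequentially intro: less_imp_le)
      then have "AE w in disc_area. cmod (F n w - f w) \<le> e" by (rule Linf_normD)
      moreover have "AE w in disc_area. F n w = G n w" using G[of n] by (auto simp: R_def)
      ultimately have "AE w in disc_area. cmod (g w - G n w) \<le> e"
        using g(2) by eventually_elim (simp add: norm_minus_commute)
      \<comment> \<open>Between continuous functions an essential bound holds at every point, which
        turns norm convergence into uniform approximation.\<close>
      then have "cmod (g w - G n w) \<le> e" if "w \<in> disc" for w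
        by (rule AE_continuous_le[rotated]) (use g G[of n] that in \<open>auto simp: R_def intro!: continuous_intros\<close>)
      then show "\<exists>n. \<forall>w\<in>disc. cmod (g w - G n w) \<le> e" by blast
    qed (use G in \<open>auto simp: R_def\<close>)
    moreover have "bounded (g ` disc)"
    proof -
      obtain c where "AE w in disc_area. cmod (f w) \<le> c" using f by (auto simp: L_infinity_iff)
      then have "AE w in disc_area. cmod (g w) \<le> c" using g(2) by eventually_elim simp
      then have "cmod (g w) \<le> c" if "w \<in> disc" for w
        by (rule AE_continuous_le[rotated]) (use g that in \<open>auto intro!: continuous_intros\<close>)
      then show ?thesis unfolding bounded_iff by blast
    qed
    ultimately have "R f g" using g by (simp add: R_def)
    with f show ?thesis unfolding A by blast
  qed
  show ?thesis
    unfolding cstar_subalgebra_def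
  proof (intro conjI allI ballI impI)
    show "?A \<noteq> {}" using c by blast
    show "?A \<subseteq> L_infinity" by blast
    \<comment> \<open>Scalar multiples are products with constants, which are bounded
      analytic.\<close>
    show "(\<lambda>w. a * f w) \<in> ?A" if "f \<in> ?A" for a f
      by (rule mult[OF c that])
  next
    fix F f
    assume "f \<in> L_infinity"
      and "(\<forall>n. F n \<in> ?A) \<and> (\<lambda>n. Linf_norm (\<lambda>w. F n w - f w)) \<longlonglongrightarrow> 0"
    then show "f \<in> ?A"
      by (intro closed[of f F]) blast+
  qed (fact add mult conj)+
qed

section \<open>Passage to the generated algebra and the Berezin transform\<close>

lemma U_algebra_vanishing_osc:
  assumes u: "u \<in> U_algebra"
  obtains g where "continuous_on disc g" "bounded (g ` disc)" "vanishing_osc g" "\<forall>w\<in>disc. u w = g w"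
proof -
  let ?A = "{f \<in> L_infinity. \<exists>g. continuous_on disc g \<and> bounded (g ` disc) \<and> vanishing_osc g \<and>
     (AE w in disc_area. f w = g w)}"
  have "H_infinity \<subseteq> ?A"
  proof
    fix f assume f: "f \<in> H_infinity"
    then have "bounded (f ` disc)" by (simp add: H_infinity_def)
    with f H_infinityD(2)[OF f] vanishing_osc_H_infinity[OF f] H_infinity_continuous_rep
    show "f \<in> ?A" by (auto intro!: exI[of _ f])
  qed
  \<comment> \<open>The generated algebra is an intersection, so it lies in every C*-subalgebra that
    contains the generators.\<close>
  then have "u \<in> ?A"
    using u cstar_subalgebra_vanishing_osc unfolding U_algebra_def cstar_generated_def by blast
  then obtain g where g: "continuous_on disc g" "bounded (g ` disc)" "vanishing_osc g" "AE w in disc_area. u w = g w"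
    by blast
  \<comment> \<open>Members of \<open>U_algebra\<close> are continuous, so equality almost
    everywhere improves to equality on the disc.\<close>
  have "\<forall>w\<in>disc. u w = g w"
    using u by (intro ballI continuous_rep_unique[OF _ g(1) g(4)]) (auto simp: U_algebra_def)
  then show thesis by (rule that[OF g(1-3)])
qed

text \<open>As the density has mass 1, the constant \<open>u z\<close> may be moved under the
  integral; the triangle inequality for integrals does the rest.\<close>

lemma berezin_diff_le_mean_osc:
  assumes c: "continuous_on disc u" and b: "bounded (u ` disc)" and z: "z \<in> disc"
  shows "ennreal (cmod (berezin u z - u z)) \<le> mean_osc u z"
proof -
  obtain B where B: "\<And>w. w \<in> disc \<Longrightarrow> cmod (u w) \<le> B" using b unfolding bounded_iff by (metis imageI)
  have i: "integrable disc_area (\<lambda>w. berezin_density z w *\<^sub>R u w)"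
    by (rule integrable_berezin_density[OF c B z])
  have "berezin u z = (\<integral>w. berezin_density z w *\<^sub>R u w \<partial>disc_area)"
    by (simp add: berezin_def berezin_density_def scaleR_conv_of_real mult.commute)
  moreover have "(\<integral>w. berezin_density z w *\<^sub>R u z \<partial>disc_area) = u z"
    using integral_berezin_density[OF z] by simp
  ultimately have eq: "berezin u z - u z = (\<integral>w. berezin_density z w *\<^sub>R u w - berezin_density z w *\<^sub>R u z \<partial>disc_area)"
    using i integral_berezin_density(1)[OF z] by simp
  have "ennreal (cmod (berezin u z - u z)) \<le>
      (\<integral>\<^sup>+w. ennreal (cmod (berezin_density z w *\<^sub>R u w - berezin_density z w *\<^sub>R u z)) \<partial>disc_area)"
    unfolding eq using i integral_berezin_density(1)[OF z]
    by (intro integral_norm_bound_ennreal Bochner_Integration.integrable_diff) auto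
  also have "\<dots> = mean_osc u z"
    unfolding mean_osc_def by (simp add: mult.commute flip: scaleR_diff_right)
  finally show ?thesis .
qed

theorem corollary3p4:
  fixes u :: "complex \<Rightarrow> complex"
  assumes "u \<in> U_algebra"
  shows "AE \<zeta> in circle_arc_length.
           has_nontangential_limit (\<lambda>z. berezin u z - u z) 0 \<zeta>"
proof -
  obtain g where g: "continuous_on disc g" "bounded (g ` disc)" "vanishing_osc g" "\<forall>w\<in>disc. u w = g w"
    using U_algebra_vanishing_osc[OF assms] .
  have u: "continuous_on disc u" "bounded (u ` disc)"
    using g(1,2,4) continuous_on_cong[of disc disc u g] image_cong[of disc disc u g] by auto
  \<comment> \<open>Values outside the disc are arbitrary, but the oscillation at a point of the
    disc reads only values inside.\<close>
  have "mean_osc u z = mean_osc g z" if "z \<in> disc" for z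
    unfolding mean_osc_def using g(4) that by (intro nn_integral_cong) simp
  then have le: "ennreal (cmod (berezin u z - u z)) \<le> mean_osc g z" if "z \<in> disc" for z
    using berezin_diff_le_mean_osc[OF u that] that by simp
  show ?thesis
    using g(3) unfolding vanishing_osc_def has_nontangential_limit_def
  proof (eventually_elim, intro allI impI)
    fix \<zeta> and \<alpha> :: real
    assume lim: "\<forall>\<alpha>>1. (mean_osc g \<longlongrightarrow> 0) (at \<zeta> within stolz_region \<alpha> \<zeta>)" and \<alpha>: "1 < \<alpha>"
    have "((\<lambda>z. ennreal (cmod (berezin u z - u z))) \<longlongrightarrow> 0) (at \<zeta> within stolz_region \<alpha> \<zeta>)"
    proof (rule tendsto_sandwich[OF _ _ tendsto_const])
      show "eventually (\<lambda>z. ennreal (cmod (berezin u z - u z)) \<le> mean_osc g z) (at \<zeta> within stolz_region \<alpha> \<zeta>)"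
        using eventually_stolz_region_disc by eventually_elim (rule le)
    qed (use lim \<alpha> in auto)
    then have "((\<lambda>z. cmod (berezin u z - u z)) \<longlongrightarrow> 0) (at \<zeta> within stolz_region \<alpha> \<zeta>)"
      by (subst (asm) ennreal_0[symmetric], subst (asm) tendsto_ennreal_iff) auto
    then show "((\<lambda>z. berezin u z - u z) \<longlongrightarrow> 0) (at \<zeta> within stolz_region \<alpha> \<zeta>)"
      by (rule tendsto_norm_zero_cancel)
  qed
qed

end
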